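(* Let $X$ and $Y$ be Banach spaces over $\mathbb{K}$ ($\mathbb{K}=\mathbb{R}$ or $\mathbb{C}$). If $X$ has the Grothendieck property and $Y^*$ is weakly compactly generated, then $\mathrm{QNA}(X,Y^* )=w^*\mathrm{QNA}(X,Y^* )$.
   Context: Banach spaces are over $\mathbb{K}=\mathbb{R}$ or $\mathbb{C}$. $B_X$ is the closed unit ball of $X$ and $X^*$ its topological dual. $X$ has the Grothendieck property if every sequence $(x_n^* )\subset X^*$ converging to $0$ in $\sigma(X^*,X)$ converges weakly to $0$, i.e. in $\sigma(X^*,X^{**})$. A Banach space $Z$ is weakly compactly generated (WCG) if there is a weakly compact set $K\subset Z$ whose closed linear span is $Z$. For a bounded linear operator $T\colon X\to Y^*$: $T\in\mathrm{QNA}(X,Y^* )$ if the norm closure of $T(B_X)$ intersects the sphere $\{u^*\in Y^*:\|u^*\|=\|T\|\}$; $T\in w^*\mathrm{QNA}(X,Y^* )$ if the $\sigma(Y^*,Y)$-closure of $T(B_X)$ intersects the sphere $\{u^*\in Y^*:\|u^*\|=\|T\|\}$. *)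

theory Defs
  imports "HOL-Analysis.Analysis"
begin

section \<open>Scalars and Banach spaces over them\<close>

text \<open>The scalar field is the real field or the complex field. In the second disjunct,
  \<open>j\<close> plays the role of the imaginary unit.\<close>

class real_or_complex = real_normed_field + banach +
  assumes real_or_complex:
    "(\<forall>z. \<exists>a. z = a *\<^sub>R 1) \<or>
     (\<exists>j. j * j = - 1 \<and> (\<forall>z. \<exists>a b. z = a *\<^sub>R 1 + b *\<^sub>R j)
        \<and> (\<forall>a b. norm (a *\<^sub>R 1 + b *\<^sub>R j) = sqrt (a\<^sup>2 + b\<^sup>2)))"

instance real :: real_or_complex
  by standard simp

instance complex :: real_or_complex
proof
  have "z = Re z *\<^sub>R 1 + Im z *\<^sub>R \<i>" for z
    by (simp add: complex_eq_iff)
  moreover have "norm (a *\<^sub>R 1 + b *\<^sub>R \<i>) = sqrt (a\<^sup>2 + b\<^sup>2)" for a b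
    by (simp add: cmod_def)
  ultimately show "(\<forall>z::complex. \<exists>a. z = a *\<^sub>R 1) \<or>
     (\<exists>j::complex. j * j = - 1 \<and> (\<forall>z. \<exists>a b. z = a *\<^sub>R 1 + b *\<^sub>R j)
        \<and> (\<forall>a b. norm (a *\<^sub>R 1 + b *\<^sub>R j) = sqrt (a\<^sup>2 + b\<^sup>2)))"
    by (intro disjI2 exI[of _ \<i>] conjI allI) (blast | simp)+
qed

text \<open>Class \<open>banach\<close> provides the complete norm and the underlying real vector space; the locale
  adds the scalar multiplication by \<open>'k\<close>.\<close>

locale banach_over = vector_space scale
  for scale :: "'k::real_or_complex \<Rightarrow> 'x::banach \<Rightarrow> 'x" +
  assumes norm_scale: "norm (scale c x) = norm c * norm x"
    and scale_of_real: "scale (of_real r) x = r *\<^sub>R x"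

lemma banach_over_scaleR: "banach_over (scaleR :: real \<Rightarrow> 'x::banach \<Rightarrow> 'x)"
  by unfold_locales (auto simp: algebra_simps)

lemma banach_over_mult: "banach_over ((*) :: 'k::real_or_complex \<Rightarrow> 'k \<Rightarrow> 'k)"
  by unfold_locales (auto simp: algebra_simps norm_mult scaleR_conv_of_real)


section \<open>Duals and weak topologies\<close>

text \<open>The type \<open>'x \<Rightarrow>\<^sub>L 'k\<close> consists of the bounded \<^emph>\<open>real\<close>-linear maps. The dual is the closed
  subspace of the \<open>'k\<close>-linear ones, with the inherited norm and scalar multiplication.\<close>

definition dual :: "('k::real_or_complex \<Rightarrow> 'x::banach \<Rightarrow> 'x) \<Rightarrow> ('x \<Rightarrow>\<^sub>L 'k) set" where
  "dual s = {f. \<forall>c x. blinfun_apply f (s c x) = c * blinfun_apply f x}"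

lift_definition dual_scale ::
    "'k::real_or_complex \<Rightarrow> ('x::real_normed_vector \<Rightarrow>\<^sub>L 'k) \<Rightarrow> ('x \<Rightarrow>\<^sub>L 'k)"
  is "\<lambda>c f x. c * f x"
  by (rule bounded_linear_const_mult)

lemma banach_over_dual_scale:
  "banach_over (dual_scale :: 'k::real_or_complex \<Rightarrow> ('x::real_normed_vector \<Rightarrow>\<^sub>L 'k) \<Rightarrow> _)"
proof
  fix c :: 'k and f :: "'x \<Rightarrow>\<^sub>L 'k"
  show "norm (dual_scale c f) = norm c * norm f"
  proof (cases "c = 0")
    case True
    then have "dual_scale c f = 0"
      by (intro blinfun_eqI) (simp add: dual_scale.rep_eq)
    with True show ?thesis by simp
  next
    case False
    have le: "norm (dual_scale d g) \<le> norm d * norm g" for d :: 'k and g :: "'x \<Rightarrow>\<^sub>L 'k"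
    proof (rule norm_blinfun_bound)
      show "norm (dual_scale d g x) \<le> norm d * norm g * norm x" for x
        using mult_left_mono[OF norm_blinfun[of g x], of "norm d"]
        by (simp add: dual_scale.rep_eq norm_mult mult.assoc)
    qed simp
    have "f = dual_scale (inverse c) (dual_scale c f)"
      using False by (intro blinfun_eqI) (simp add: dual_scale.rep_eq)
    then have "norm f \<le> norm (inverse c) * norm (dual_scale c f)"
      by (metis le)
    then have "norm c * norm f \<le> norm (dual_scale c f)"
      using False by (simp add: norm_divide field_simps)
    with le[of c f] show ?thesis by linarith
  qed
qed (auto intro!: blinfun_eqI simp: dual_scale.rep_eq blinfun.bilinear_simps
       algebra_simps scaleR_conv_of_real)

text \<open>Banach spaces that need not be a whole type, such as \<open>dual s\<close>, are given by a carrier \<open>Z\<close>.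
  The values of a functional outside \<open>Z\<close> are irrelevant.\<close>

definition functionals_on ::
    "('k::real_or_complex \<Rightarrow> 'z::real_normed_vector \<Rightarrow> 'z) \<Rightarrow> 'z set \<Rightarrow> ('z \<Rightarrow> 'k) set" where
  "functionals_on s Z =
     {\<phi>. (\<forall>x\<in>Z. \<forall>y\<in>Z. \<phi> (x + y) = \<phi> x + \<phi> y) \<and>
         (\<forall>c. \<forall>x\<in>Z. \<phi> (s c x) = c * \<phi> x) \<and>
         (\<exists>C. \<forall>x\<in>Z. norm (\<phi> x) \<le> C * norm x)}"

text \<open>The topology \<open>\<sigma>(Z, F)\<close>: the coarsest one on \<open>Z\<close> making all members of \<open>F\<close> continuous.\<close>

definition sigma_topology :: "'z set \<Rightarrow> ('z \<Rightarrow> 'k::topological_space) set \<Rightarrow> 'z topology" where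
  "sigma_topology Z F =
     topology_generated_by {{z \<in> Z. \<phi> z \<in> U} | \<phi> U. \<phi> \<in> F \<and> open U}"

lemma topspace_sigma_topology: "F \<noteq> {} \<Longrightarrow> topspace (sigma_topology Z F) = Z"
  unfolding sigma_topology_def topology_generated_by_topspace by auto

definition weak_topology ::
    "('k::real_or_complex \<Rightarrow> 'z::real_normed_vector \<Rightarrow> 'z) \<Rightarrow> 'z set \<Rightarrow> 'z topology" where
  "weak_topology s Z = sigma_topology Z (functionals_on s Z)"

definition weak_star_topology ::
    "('k::real_or_complex \<Rightarrow> 'x::banach \<Rightarrow> 'x) \<Rightarrow> ('x \<Rightarrow>\<^sub>L 'k) topology" where
  "weak_star_topology s = sigma_topology (dual s) {\<lambda>f. blinfun_apply f x | x. True}"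

definition grothendieck_property :: "('k::real_or_complex \<Rightarrow> 'x::banach \<Rightarrow> 'x) \<Rightarrow> bool" where
  "grothendieck_property s \<longleftrightarrow>
     (\<forall>f :: nat \<Rightarrow> 'x \<Rightarrow>\<^sub>L 'k. range f \<subseteq> dual s \<longrightarrow>
        limitin (weak_star_topology s) f 0 sequentially \<longrightarrow>
        limitin (weak_topology dual_scale (dual s)) f 0 sequentially)"

definition weakly_compactly_generated ::
    "('k::real_or_complex \<Rightarrow> 'z::real_normed_vector \<Rightarrow> 'z) \<Rightarrow> 'z set \<Rightarrow> bool" where
  "weakly_compactly_generated s Z \<longleftrightarrow>
     (\<exists>K. compactin (weak_topology s Z) K \<and> closure (module.span s K) = Z)"


section \<open>Quasi norm attaining operators into a dual space\<close>

definition operators_to_dual ::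
    "('k::real_or_complex \<Rightarrow> 'x::banach \<Rightarrow> 'x) \<Rightarrow> ('k \<Rightarrow> 'y::banach \<Rightarrow> 'y)
      \<Rightarrow> ('x \<Rightarrow>\<^sub>L ('y \<Rightarrow>\<^sub>L 'k)) set" where
  "operators_to_dual sX sY =
     {T. (\<forall>x. blinfun_apply T x \<in> dual sY) \<and>
         (\<forall>c x. blinfun_apply T (sX c x) = dual_scale c (blinfun_apply T x))}"

definition QNA ::
    "('k::real_or_complex \<Rightarrow> 'x::banach \<Rightarrow> 'x) \<Rightarrow> ('k \<Rightarrow> 'y::banach \<Rightarrow> 'y)
      \<Rightarrow> ('x \<Rightarrow>\<^sub>L ('y \<Rightarrow>\<^sub>L 'k)) set" where
  "QNA sX sY =
     {T \<in> operators_to_dual sX sY.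
        closure (blinfun_apply T ` cball 0 1) \<inter> {u \<in> dual sY. norm u = norm T} \<noteq> {}}"

definition weak_star_QNA ::
    "('k::real_or_complex \<Rightarrow> 'x::banach \<Rightarrow> 'x) \<Rightarrow> ('k \<Rightarrow> 'y::banach \<Rightarrow> 'y)
      \<Rightarrow> ('x \<Rightarrow>\<^sub>L ('y \<Rightarrow>\<^sub>L 'k)) set" where
  "weak_star_QNA sX sY =
     {T \<in> operators_to_dual sX sY.
        (weak_star_topology sY closure_of (blinfun_apply T ` cball 0 1))
          \<inter> {u \<in> dual sY. norm u = norm T} \<noteq> {}}"

end

theory Submission
  imports Defs
begin

text \<open>Suppose that \<open>u\<close> lies in the weak-star closure of \<open>T B\<^sub>X\<close> but not in its norm closure. Hahn-Banach
  yields \<open>\<Phi>\<close> in the bidual of \<open>Y\<close> with \<open>\<bar>\<Phi> (T x)\<bar> \<le> \<bar>x\<bar>\<close> and \<open>Re (\<Phi> u) > 1\<close>. As \<open>Y\<^sup>*\<close> is weakly compactly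
  generated, \<open>\<Phi>\<close> is the pointwise limit on \<open>Y\<^sup>*\<close> of a \<^emph>\<open>sequence\<close> \<open>y\<^sub>n\<close> in \<open>Y\<close>. Then \<open>T\<^sup>* y\<^sub>n\<close> converges to
  \<open>T\<^sup>* \<Phi>\<close> weak-star, hence weakly by the Grothendieck property. Since \<open>u\<close> is in the weak-star closure,
  \<open>\<bar>u y\<bar> \<le> \<bar>T\<^sup>* y\<bar>\<close>, so \<open>u\<close> factors through \<open>T\<^sup>*\<close> as a functional \<open>\<Psi>\<close> of norm at most 1 on the dual of \<open>X\<close>,
  and \<open>\<Phi> u = lim u y\<^sub>n = \<Psi> (T\<^sup>* \<Phi>)\<close> has modulus at most 1, a contradiction.\<close>

section \<open>Real parts of scalars\<close>

text \<open>Taking \<open>j = 0\<close> for real scalars lets most later arguments treat both fields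
  at once. The bound on \<open>\<bar>a\<bar>\<close> is what makes the real coordinate unique and
  \<open>real_part\<close> a contraction.\<close>

definition imag_unit_axiom :: "'k::real_or_complex \<Rightarrow> bool" where
  "imag_unit_axiom j \<longleftrightarrow> (j = 0 \<or> j * j = - 1) \<and> (\<forall>z. \<exists>a b. z = of_real a + of_real b * j) \<and>
     (\<forall>a b. \<bar>a\<bar> \<le> norm (of_real a + of_real b * j))"

text \<open>The value is \<open>0\<close> if the scalars are real.\<close>

definition imag_unit :: "'k::real_or_complex" where
  "imag_unit = (SOME j. imag_unit_axiom j)"

text \<open>Only \<open>a\<close> is determined by \<open>z\<close>: when \<open>imag_unit\<close>
  is \<open>0\<close>, every \<open>b\<close> represents the same scalar.\<close>

definition real_part :: "'k::real_or_complex \<Rightarrow> real" where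
  "real_part z = (SOME a. \<exists>b. z = of_real a + of_real b * imag_unit)"

lemma imag_unit_axiom: "imag_unit_axiom (imag_unit :: 'k::real_or_complex)"
proof -
  have "\<exists>j::'k. imag_unit_axiom j"
    using real_or_complex[where ?'a = 'k]
  proof
    assume "\<forall>z::'k. \<exists>a. z = a *\<^sub>R 1"
    then show ?thesis
      by (intro exI[of _ 0]) (auto simp: imag_unit_axiom_def of_real_def)
  next
    assume "\<exists>j::'k. j * j = - 1 \<and> (\<forall>z. \<exists>a b. z = a *\<^sub>R 1 + b *\<^sub>R j)
        \<and> (\<forall>a b. norm (a *\<^sub>R 1 + b *\<^sub>R j) = sqrt (a\<^sup>2 + b\<^sup>2))"
    then show ?thesis
      by (auto simp: imag_unit_axiom_def of_real_def)
  qed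
  then show ?thesis
    unfolding imag_unit_def by (rule someI_ex)
qed

lemma imag_unit_cases: "imag_unit = (0::'k::real_or_complex) \<or> imag_unit * imag_unit = (- 1::'k)"
  using imag_unit_axiom by (auto simp: imag_unit_axiom_def)

lemma abs_le_norm_imag_unit: "\<bar>a\<bar> \<le> norm (of_real a + of_real b * (imag_unit::'k::real_or_complex))"
  using imag_unit_axiom by (auto simp: imag_unit_axiom_def)

lemma scalar_cases:
  obtains a b where "z = of_real a + of_real b * (imag_unit::'k::real_or_complex)"
  using imag_unit_axiom[where ?'k = 'k] that unfolding imag_unit_axiom_def by blast

text \<open>Two representations of one scalar differ by a representation of \<open>0\<close>, whose
  real coordinate is bounded by the norm of \<open>0\<close>.\<close>

lemma real_part_eq [simp]:
  "real_part (of_real a + of_real b * (imag_unit::'k::real_or_complex)) = a"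
  unfolding real_part_def
proof (rule some_equality)
  fix a' assume "\<exists>b'. of_real a + of_real b * (imag_unit::'k) = of_real a' + of_real b' * imag_unit"
  then obtain b' where "of_real a + of_real b * (imag_unit::'k) = of_real a' + of_real b' * imag_unit" ..
  then have "of_real (a - a') + of_real (b - b') * (imag_unit::'k) = 0"
    by (simp add: algebra_simps)
  with abs_le_norm_imag_unit[of "a - a'" "b - b'", where ?'k = 'k] show "a' = a" by simp
qed blast

lemma real_part_of_real [simp]: "real_part (of_real a :: 'k::real_or_complex) = a"
  using real_part_eq[of a 0, where ?'k = 'k] by simp

lemma real_part_0 [simp]: "real_part (0 :: 'k::real_or_complex) = 0"
  using real_part_of_real[of 0, where ?'k = 'k] by simp

lemma real_part_add: "real_part (w + z) = real_part w + real_part (z::'k::real_or_complex)"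
proof (cases w rule: scalar_cases, cases z rule: scalar_cases)
  fix a b c d assume "w = of_real a + of_real b * imag_unit" "z = of_real c + of_real d * imag_unit"
  then have "w + z = of_real (a + c) + of_real (b + d) * imag_unit"
    by (simp add: algebra_simps)
  then show ?thesis
    unfolding \<open>w = _\<close> \<open>z = _\<close> by (metis real_part_eq)
qed

lemma real_part_of_real_mult: "real_part (of_real r * z) = r * real_part (z::'k::real_or_complex)"
proof (cases z rule: scalar_cases)
  fix a b assume "z = of_real a + of_real b * imag_unit"
  then have "of_real r * z = of_real (r * a) + of_real (r * b) * imag_unit"
    by (simp add: algebra_simps)
  then show ?thesis
    unfolding \<open>z = _\<close> by (metis real_part_eq)
qed

lemma real_part_scaleR: "real_part (r *\<^sub>R z) = r * real_part (z::'k::real_or_complex)"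
  by (simp add: scaleR_conv_of_real real_part_of_real_mult)

lemma real_part_le: "\<bar>real_part z\<bar> \<le> norm (z::'k::real_or_complex)"
  by (cases z rule: scalar_cases) (simp add: abs_le_norm_imag_unit)

lemma bounded_linear_real_part: "bounded_linear (real_part :: 'k::real_or_complex \<Rightarrow> real)"
  by (rule bounded_linear_intro[of _ 1]) (auto simp: real_part_add real_part_scaleR real_part_le)

lemmas real_part_diff = bounded_linear.linear[OF bounded_linear_real_part, THEN linear_diff]
lemmas real_part_minus = bounded_linear.linear[OF bounded_linear_real_part, THEN linear_neg]
lemmas real_part_sum = bounded_linear.linear[OF bounded_linear_real_part, THEN linear_sum]

text \<open>For \<open>z = a + b j\<close> with \<open>j * j = - 1\<close>, the real part of
  \<open>j * z\<close> is \<open>- b\<close>, hence the minus sign. Over the reals the second term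
  vanishes with \<open>imag_unit\<close>. Thus real parts of multiples of \<open>z\<close> determine
  \<open>z\<close>.\<close>

lemma scalar_decomp:
  "z = of_real (real_part z) - imag_unit * of_real (real_part (imag_unit * (z::'k::real_or_complex)))"
proof (cases z rule: scalar_cases)
  fix a b assume z: "z = of_real a + of_real b * imag_unit"
  show ?thesis
  proof (cases "imag_unit = (0::'k)")
    case True
    then show ?thesis using z by simp
  next
    case False
    then have "imag_unit * imag_unit = (- 1::'k)"
      using imag_unit_cases by blast
    then have jj: "imag_unit * (imag_unit * x) = - x" for x :: 'k
      by (simp flip: mult.assoc)
    have "imag_unit * z = of_real (- b) + of_real a * imag_unit"
      by (simp add: z jj algebra_simps)
    then have "real_part (imag_unit * z) = - b" by (metis real_part_eq)
    moreover have "real_part z = a" by (simp add: z)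
    ultimately show ?thesis by (simp add: z algebra_simps)
  qed
qed

lemma norm_le_real_parts:
  "norm z \<le> \<bar>real_part z\<bar> + norm (imag_unit::'k) * \<bar>real_part (imag_unit * (z::'k::real_or_complex))\<bar>"
  by (subst (1) scalar_decomp, rule order_trans[OF norm_triangle_ineq4]) (simp add: norm_mult)

text \<open>The rotation \<open>norm z / z\<close> turns bounds on real parts of all unimodular
  multiples into bounds on the modulus.\<close>

lemma scalar_rotate:
  obtains c :: "'k::real_or_complex" where "norm c = 1" "real_part (c * z) = norm z"
proof (cases "z = 0")
  case True
  then show ?thesis using that[of 1] by simp
next
  case False
  then show ?thesis
    using that[of "of_real (norm z) / z"] by (simp add: norm_divide)
qed

text \<open>One-sided inequalities suffice because some unimodular \<open>c\<close> makes the real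
  part of \<open>c * (z - w)\<close> equal to \<open>norm (z - w)\<close>. Hahn-Banach arguments
  produce exactly such inequalities.\<close>

lemma scalar_eqI:
  fixes z w :: "'k::real_or_complex"
  assumes "\<And>c. real_part (c * z) \<le> real_part (c * w)"
  shows "z = w"
proof -
  obtain c where "norm c = 1" "real_part (c * (z - w)) = norm (z - w)"
    by (rule scalar_rotate)
  then have "real_part (c * z) - real_part (c * w) = norm (z - w)"
    by (simp add: right_diff_distrib real_part_diff)
  with assms[of c] have "norm (z - w) \<le> 0" by linarith
  then show ?thesis by simp
qed

text \<open>Upper estimates for all multiples are enough: \<open>- c\<close> supplies the lower
  ones, and \<open>c = imag_unit\<close> the remaining coordinate in
  \<open>scalar_decomp\<close>.\<close>

lemma tendsto_of_real_part:
  fixes z :: "nat \<Rightarrow> 'k::real_or_complex"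
  assumes "\<And>c b. real_part (c * w) < b \<Longrightarrow> \<forall>\<^sub>F n in sequentially. real_part (c * z n) < b"
  shows "z \<longlonglongrightarrow> w"
proof -
  have re: "(\<lambda>n. real_part (c * z n)) \<longlonglongrightarrow> real_part (c * w)" for c
  proof (rule order_tendstoI)
    fix a assume "a < real_part (c * w)"
    then have "real_part (- c * w) < - a" by (simp add: real_part_minus)
    from assms[OF this] show "\<forall>\<^sub>F n in sequentially. a < real_part (c * z n)"
      by (simp add: real_part_minus)
  qed (use assms in auto)
  have "(\<lambda>n. of_real (real_part (z n)) - imag_unit * of_real (real_part (imag_unit * z n)))
     \<longlonglongrightarrow> of_real (real_part w) - imag_unit * of_real (real_part (imag_unit * w))"
    using re[of 1] re[of imag_unit] by (intro tendsto_intros) simp_all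
  from tendsto_eq_rhs[OF this scalar_decomp[symmetric]] show ?thesis
    by (rule Lim_transform_eventually) (intro always_eventually allI scalar_decomp[symmetric])
qed

section \<open>Scalar-linear extension of real-linear functionals\<close>

text \<open>The Bohnenblust-Sobczyk formula: the scalar-linear functional whose real part is
  \<open>\<phi>\<close>. Over the reals it is \<open>\<phi>\<close> itself, as
  \<open>imag_unit\<close> is then \<open>0\<close>.\<close>

definition scalar_ext ::
    "('k::real_or_complex \<Rightarrow> 'x::real_vector \<Rightarrow> 'x) \<Rightarrow> ('x \<Rightarrow> real) \<Rightarrow> 'x \<Rightarrow> 'k" where
  "scalar_ext s \<phi> x = of_real (\<phi> x) - imag_unit * of_real (\<phi> (s imag_unit x))"

context banach_over
begin

context
  fixes \<phi> :: "'x::banach \<Rightarrow> real"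
  assumes lin: "linear \<phi>"
begin

lemma scalar_ext_add: "scalar_ext scale \<phi> (x + y) = scalar_ext scale \<phi> x + scalar_ext scale \<phi> y"
  by (simp add: scalar_ext_def scale_right_distrib linear_add[OF lin] algebra_simps)

lemma scalar_ext_scale: "scalar_ext scale \<phi> (scale c x) = c * scalar_ext scale \<phi> x"
proof (cases c rule: scalar_cases)
  fix a b assume c: "c = of_real a + of_real b * imag_unit"
  have r: "scalar_ext scale \<phi> (scale (of_real r) x) = of_real r * scalar_ext scale \<phi> x" for r x
  proof -
    have "scale imag_unit (r *\<^sub>R x) = r *\<^sub>R scale imag_unit x"
      using scale_left_commute[of imag_unit "of_real r" x] by (simp only: scale_of_real)
    then show ?thesis
      unfolding scale_of_real scalar_ext_def by (simp add: linear_scale[OF lin] algebra_simps)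
  qed
  have i: "scalar_ext scale \<phi> (scale imag_unit x) = imag_unit * scalar_ext scale \<phi> x"
  proof (cases "imag_unit = (0::'k)")
    case True
    then show ?thesis by (simp add: scalar_ext_def linear_0[OF lin])
  next
    case False
    then have "imag_unit * imag_unit = (- 1::'k)"
      using imag_unit_cases by blast
    then show ?thesis
      by (simp add: scalar_ext_def linear_neg[OF lin] algebra_simps flip: mult.assoc)
  qed
  show ?thesis
    by (simp add: c scale_left_distrib scalar_ext_add r i flip: scale_scale)
      (simp add: algebra_simps)
qed

lemma real_part_scalar_ext: "real_part (scalar_ext scale \<phi> x) = \<phi> x"
  using real_part_eq[of "\<phi> x" "- \<phi> (scale imag_unit x)", where ?'k = 'k]
  by (simp add: scalar_ext_def mult.commute)

text \<open>Rotating the value to a nonnegative real turns the modulus into \<open>\<phi>\<close> at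
  a unimodular multiple of \<open>x\<close>, so the extension costs no constant.\<close>

lemma norm_scalar_ext_le:
  assumes "\<And>c. norm c = 1 \<Longrightarrow> \<phi> (scale c x) \<le> b"
  shows "norm (scalar_ext scale \<phi> x) \<le> b"
proof -
  obtain c where "norm c = 1" "real_part (c * scalar_ext scale \<phi> x) = norm (scalar_ext scale \<phi> x)"
    by (rule scalar_rotate)
  with assms[of c] show ?thesis
    by (metis scalar_ext_scale real_part_scalar_ext)
qed

end

end

section \<open>The Hahn-Banach theorem\<close>

text \<open>Homogeneity has the form of an inequality, the direction that infima deliver directly;
  \<open>sublinear_scale\<close> recovers equality by applying it to
  \<open>inverse r\<close>.\<close>

definition sublinear :: "('a::real_vector \<Rightarrow> real) \<Rightarrow> bool" where
  "sublinear p \<longleftrightarrow> (\<forall>x y. p (x + y) \<le> p x + p y) \<and> (\<forall>x r. 0 < r \<longrightarrow> p (r *\<^sub>R x) \<le> r * p x) \<and> p 0 = 0"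

lemma sublinear_add: "sublinear p \<Longrightarrow> p (x + y) \<le> p x + p y"
  and sublinear_scale_le: "sublinear p \<Longrightarrow> 0 < r \<Longrightarrow> p (r *\<^sub>R x) \<le> r * p x"
  and sublinear_0: "sublinear p \<Longrightarrow> p 0 = 0"
  by (auto simp: sublinear_def)

lemma sublinear_scale:
  assumes "sublinear p" "0 \<le> r"
  shows "p (r *\<^sub>R x) = r * p x"
proof (cases "r = 0")
  case False
  with assms have r: "0 < r" by simp
  have "p x \<le> inverse r * p (r *\<^sub>R x)"
    using sublinear_scale_le[OF assms(1), of "inverse r" "r *\<^sub>R x"] r by simp
  then have "r * p x \<le> p (r *\<^sub>R x)"
    using r by (simp add: field_simps)
  with sublinear_scale_le[OF assms(1) r, of x] show ?thesis by simp
qed (simp add: sublinear_0[OF assms(1)])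

lemma sublinear_neg: "sublinear p \<Longrightarrow> - p (- x) \<le> p x"
  using sublinear_add[of p x "- x"] by (simp add: sublinear_0)

text \<open>A pair \<open>(v, c)\<close> in the cone \<open>G\<close> is the constraint that the
  value at \<open>v\<close> be at most \<open>c\<close>. The infimal convolution of \<open>p\<close>
  with \<open>G\<close> meets all constraints at once; the last hypothesis bounds the infimum at
  \<open>h\<close> below by \<open>- p (- h)\<close>, so it is finite.\<close>

lemma sublinear_inf_convolution:
  fixes p :: "'a::real_vector \<Rightarrow> real" and G :: "('a \<times> real) set"
  assumes p: "sublinear p"
    and zero: "(0, 0) \<in> G"
    and add: "\<And>v c w d. (v, c) \<in> G \<Longrightarrow> (w, d) \<in> G \<Longrightarrow> (v + w, c + d) \<in> G"
    and scale: "\<And>v c r. (v, c) \<in> G \<Longrightarrow> 0 < r \<Longrightarrow> (r *\<^sub>R v, r * c) \<in> G"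
    and nonneg: "\<And>v c. (v, c) \<in> G \<Longrightarrow> 0 \<le> p (- v) + c"
  shows "\<exists>q. sublinear q \<and> (\<forall>x. q x \<le> p x) \<and> (\<forall>v c. (v, c) \<in> G \<longrightarrow> q v \<le> c)"
proof (intro exI conjI allI impI)
  define q where "q h = (INF (v, c) \<in> G. p (h - v) + c)" for h
  have ne: "G \<noteq> {}" using zero by auto
  have lower: "- p (- h) \<le> p (h - v) + c" if "(v, c) \<in> G" for h v c
    using sublinear_add[OF p, of "- h" "h - v"] nonneg[OF that] by simp
  have bdd: "bdd_below ((\<lambda>(v, c). p (h - v) + c) ` G)" for h
    using lower by (intro bdd_belowI2[of _ "- p (- h)"]) auto
  have q_le: "q h \<le> p (h - v) + c" if "(v, c) \<in> G" for h v c
    unfolding q_def using cINF_lower[OF bdd that, of h] by simp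
  have q_ge: "b \<le> q h" if "\<And>v c. (v, c) \<in> G \<Longrightarrow> b \<le> p (h - v) + c" for b h
    unfolding q_def using that by (intro cINF_greatest[OF ne]) auto
  show "q h \<le> p h" for h
    using q_le[OF zero, of h] by simp
  show "q v \<le> c" if "(v, c) \<in> G" for v c
    using q_le[OF that, of v] sublinear_0[OF p] by simp
  show "sublinear q"
    unfolding sublinear_def
  proof (intro conjI allI impI)
    fix x y
    have "q (x + y) - (p (x - v) + c) \<le> p (y - w) + d" if "(v, c) \<in> G" "(w, d) \<in> G" for v c w d
      using q_le[OF add[OF that], of "x + y"] sublinear_add[OF p, of "x - v" "y - w"]
      by (simp add: algebra_simps)
    then have "q (x + y) - (p (x - v) + c) \<le> q y" if "(v, c) \<in> G" for v c
      using that by (intro q_ge)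
    then have "q (x + y) - q y \<le> q x"
      by (intro q_ge) (auto simp: algebra_simps)
    then show "q (x + y) \<le> q x + q y" by simp
  next
    fix x and r :: real assume r: "0 < r"
    have "q (r *\<^sub>R x) / r \<le> q x"
    proof (rule q_ge)
      fix v c assume "(v, c) \<in> G"
      from q_le[OF scale[OF this r], of "r *\<^sub>R x"] sublinear_scale_le[OF p r, of "x - v"]
      show "q (r *\<^sub>R x) / r \<le> p (x - v) + c"
        using r by (simp add: field_simps)
    qed
    then show "q (r *\<^sub>R x) \<le> r * q x"
      using r by (simp add: field_simps)
  next
    show "q 0 = 0"
      using q_le[OF zero, of 0] q_ge[of 0 0] nonneg sublinear_0[OF p] by simp
  qed
qed

text \<open>The pointwise infimum works: \<open>- p (- x)\<close> bounds every member below at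
  \<open>x\<close>, and the smaller of two members of the chain serves for both summands in
  subadditivity.\<close>

lemma sublinear_chain_Inf:
  fixes C :: "('a::real_vector \<Rightarrow> real) set"
  assumes ne: "C \<noteq> {}"
    and C: "\<And>s. s \<in> C \<Longrightarrow> sublinear s \<and> (\<forall>x. s x \<le> p x)"
    and chain: "\<And>s t. s \<in> C \<Longrightarrow> t \<in> C \<Longrightarrow> s \<le> t \<or> t \<le> s"
  shows "\<exists>q. sublinear q \<and> (\<forall>s\<in>C. q \<le> s)"
proof -
  define q where "q x = (INF s\<in>C. s x)" for x
  have "- p (- x) \<le> s x" if "s \<in> C" for s x
    using C[OF that] sublinear_neg[of s x] by (smt (verit))
  then have bdd: "bdd_below ((\<lambda>s. s x) ` C)" for x
    by (intro bdd_belowI2[of _ "- p (- x)"])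
  have q_le: "q x \<le> s x" if "s \<in> C" for s x
    unfolding q_def using bdd that by (rule cINF_lower)
  have q_ge: "b \<le> q x" if "\<And>s. s \<in> C \<Longrightarrow> b \<le> s x" for b x
    unfolding q_def using ne that by (rule cINF_greatest)
  have add: "q (x + y) - s x \<le> t y" if "s \<in> C" "t \<in> C" for s t x y
  proof (cases "s \<le> t")
    case True
    then have "s y \<le> t y" by (rule le_funD)
    then show ?thesis
      using q_le[OF that(1), of "x + y"] C[OF that(1)] sublinear_add[of s x y] by simp
  next
    case False
    then have "t x \<le> s x" using chain[OF that] by (auto dest: le_funD)
    then show ?thesis
      using q_le[OF that(2), of "x + y"] C[OF that(2)] sublinear_add[of t x y] by simp
  qed
  have "sublinear q"
    unfolding sublinear_def
  proof (intro conjI allI impI)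
    fix x y
    have "q (x + y) - s x \<le> q y" if "s \<in> C" for s
      using add that by (intro q_ge)
    then have "q (x + y) - q y \<le> q x"
      by (intro q_ge) (auto simp: algebra_simps)
    then show "q (x + y) \<le> q x + q y" by simp
  next
    fix x and r :: real assume r: "0 < r"
    have "q (r *\<^sub>R x) / r \<le> q x"
    proof (rule q_ge)
      fix s assume "s \<in> C"
      with q_le[OF this, of "r *\<^sub>R x"] sublinear_scale_le[OF _ r, of s x] C[OF this]
      show "q (r *\<^sub>R x) / r \<le> s x"
        using r by (simp add: field_simps)
    qed
    then show "q (r *\<^sub>R x) \<le> r * q x"
      using r by (simp add: field_simps)
  next
    show "q 0 = 0"
      using ne C by (simp add: q_def sublinear_0)
  qed
  with q_le show ?thesis by (auto simp: le_fun_def)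
qed

text \<open>Lowering \<open>m\<close> so that its value at \<open>- x\<close> is at most
  \<open>- m x\<close> stays within sublinear functions, so minimality makes \<open>m\<close> odd;
  an odd sublinear function is linear.\<close>

lemma minimal_sublinear_linear:
  assumes m: "sublinear m" and min: "\<And>q. sublinear q \<Longrightarrow> q \<le> m \<Longrightarrow> q = m"
  shows "linear m"
proof -
  have neg: "m (- x) = - m x" for x
  proof -
    \<comment> \<open>The ray generated by the single constraint that the value at
      \<open>- x\<close> be at most \<open>- m x\<close>. It is consistent since
      \<open>m (t *\<^sub>R x) - t * m x = 0\<close>.\<close>
    define G where "G = {(- t *\<^sub>R x, - t * m x) | t. 0 \<le> t}"
    have "\<exists>q. sublinear q \<and> (\<forall>y. q y \<le> m y) \<and> (\<forall>v c. (v, c) \<in> G \<longrightarrow> q v \<le> c)"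
    proof (rule sublinear_inf_convolution[OF m, of G])
      show "(0, 0) \<in> G"
        unfolding G_def by force
      show "(v + w, c + d) \<in> G" if "(v, c) \<in> G" "(w, d) \<in> G" for v c w d
      proof -
        from that obtain t t' where "v = - t *\<^sub>R x" "c = - t * m x" "0 \<le> t"
          "w = - t' *\<^sub>R x" "d = - t' * m x" "0 \<le> t'"
          by (auto simp: G_def)
        then have "v + w = - (t + t') *\<^sub>R x \<and> c + d = - (t + t') * m x \<and> 0 \<le> t + t'"
          by (simp add: algebra_simps)
        then show ?thesis unfolding G_def by blast
      qed
      show "(r *\<^sub>R v, r * c) \<in> G" if "(v, c) \<in> G" "0 < r" for v c r
      proof -
        from that(1) obtain t where "v = - t *\<^sub>R x" "c = - t * m x" "0 \<le> t"
          by (auto simp: G_def)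
        with that(2) have "r *\<^sub>R v = - (r * t) *\<^sub>R x \<and> r * c = - (r * t) * m x \<and> 0 \<le> r * t"
          by simp
        then show ?thesis unfolding G_def by blast
      qed
      show "0 \<le> m (- v) + c" if "(v, c) \<in> G" for v c
        using that sublinear_scale[OF m] by (auto simp: G_def)
    qed
    then obtain q where q: "sublinear q" "\<And>y. q y \<le> m y" "\<And>v c. (v, c) \<in> G \<Longrightarrow> q v \<le> c"
      by blast
    have "q = m"
      using q(1,2) by (intro min) (auto simp: le_fun_def)
    moreover have "(- x, - m x) \<in> G"
      unfolding G_def by (rule CollectI, rule exI[of _ 1]) simp
    ultimately have "m (- x) \<le> - m x" using q(3) by blast
    with sublinear_neg[OF m, of x] show ?thesis by simp
  qed
  show ?thesis
  proof (rule linearI)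
    fix x y
    have "m x \<le> m (x + y) + m (- y)"
      using sublinear_add[OF m, of "x + y" "- y"] by simp
    with sublinear_add[OF m, of x y] neg show "m (x + y) = m x + m y" by simp
  next
    fix r x
    show "m (r *\<^sub>R x) = r *\<^sub>R m x"
    proof (cases "0 \<le> r")
      case True
      then show ?thesis by (simp add: sublinear_scale[OF m])
    next
      case False
      then have "m ((- r) *\<^sub>R x) = (- r) * m x"
        by (intro sublinear_scale[OF m]) simp
      then show ?thesis by (simp add: neg)
    qed
  qed
qed

text \<open>Zorn's lemma in the reversed pointwise order gives a minimal sublinear function below
  \<open>p\<close>. The empty chain is bounded by \<open>p\<close>, the others by their pointwise
  infimum.\<close>

lemma linear_below_sublinear:
  assumes p: "sublinear p"
  obtains m where "linear m" "m \<le> p"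
proof -
  define A where "A = {s. sublinear s \<and> s \<le> p}"
  have "\<exists>m\<in>A. \<forall>a\<in>A. m \<ge> a \<longrightarrow> a = m"
  proof (rule predicate_Zorn)
    show "partial_order_on A (relation_of (\<ge>) A)"
      by (rule partial_order_on_relation_ofI) auto
    fix C assume C: "C \<in> Chains (relation_of (\<ge>) A)"
    show "\<exists>u\<in>A. \<forall>a\<in>C. a \<ge> u"
    proof (cases "C = {}")
      case True
      then show ?thesis using p by (auto simp: A_def)
    next
      case False
      have CA: "C \<subseteq> A" and chain: "s \<le> t \<or> t \<le> s" if "s \<in> C" "t \<in> C" for s t
        using C that by (auto simp: Chains_def relation_of_def)
      have CA: "s \<in> A" if "s \<in> C" for s
        using CA[OF that that] that by blast
      obtain q where q: "sublinear q" "\<forall>s\<in>C. q \<le> s"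
        using sublinear_chain_Inf[of C p] False CA chain by (auto simp: A_def le_fun_def)
      with False CA have "q \<le> p"
        unfolding A_def by (metis (mono_tags, lifting) equals0I mem_Collect_eq order_trans)
      with q show ?thesis by (auto simp: A_def)
    qed
  qed
  then obtain m where m: "m \<in> A" "\<And>a. a \<in> A \<Longrightarrow> a \<le> m \<Longrightarrow> a = m" by blast
  have "linear m"
    using m by (intro minimal_sublinear_linear) (auto simp: A_def)
  with m show ?thesis using that by (auto simp: A_def)
qed

text \<open>One form for domination by \<open>p\<close> together with a cone of upper bounds; Banach
  limits, separation and extension are all instances. The last hypothesis is consistency: a solution
  gives \<open>0 = \<phi> (- v) + \<phi> v \<le> p (- v) + c\<close>.\<close>

theorem hahn_banach_cone:
  fixes p :: "'a::real_vector \<Rightarrow> real" and G :: "('a \<times> real) set"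
  assumes "sublinear p"
    and "(0, 0) \<in> G"
    and "\<And>v c w d. (v, c) \<in> G \<Longrightarrow> (w, d) \<in> G \<Longrightarrow> (v + w, c + d) \<in> G"
    and "\<And>v c r. (v, c) \<in> G \<Longrightarrow> 0 < r \<Longrightarrow> (r *\<^sub>R v, r * c) \<in> G"
    and "\<And>v c. (v, c) \<in> G \<Longrightarrow> 0 \<le> p (- v) + c"
  shows "\<exists>\<phi>. linear \<phi> \<and> (\<forall>x. \<phi> x \<le> p x) \<and> (\<forall>v c. (v, c) \<in> G \<longrightarrow> \<phi> v \<le> c)"
proof -
  have "\<exists>q. sublinear q \<and> (\<forall>x. q x \<le> p x) \<and> (\<forall>v c. (v, c) \<in> G \<longrightarrow> q v \<le> c)"
    using assms by (rule sublinear_inf_convolution)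
  then obtain q
    where q: "sublinear q" "\<And>x. q x \<le> p x" "\<And>v c. (v, c) \<in> G \<Longrightarrow> q v \<le> c"
    by blast
  obtain \<phi> where "linear \<phi>" "\<phi> \<le> q"
    using linear_below_sublinear[OF q(1)] .
  with q show ?thesis
    by (meson le_funD order_trans)
qed

lemma sublinear_norm: "0 \<le> M \<Longrightarrow> sublinear (\<lambda>x::'a::real_normed_vector. M * norm x)"
  unfolding sublinear_def distrib_left[symmetric]
  by (auto intro!: mult_left_mono norm_triangle_ineq)

section \<open>Topologies generated by functionals\<close>

lemma openin_sigma_topology:
  "\<phi> \<in> F \<Longrightarrow> open U \<Longrightarrow> openin (sigma_topology Z F) {z \<in> Z. \<phi> z \<in> U}"
  unfolding sigma_topology_def by (rule topology_generated_by_Basis) blast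

text \<open>Eventual membership of the sequence passes from the generating sets to finite
  intersections and unions, so testing against single members of \<open>F\<close> is enough.\<close>

lemma limitin_sigma_topology:
  assumes F: "F \<noteq> {}" and f: "range f \<subseteq> Z" and l: "l \<in> Z"
  shows "limitin (sigma_topology Z F) f l sequentially \<longleftrightarrow> (\<forall>\<phi>\<in>F. (\<lambda>n. \<phi> (f n)) \<longlonglongrightarrow> \<phi> l)"
proof (intro iffI ballI)
  fix \<phi> assume lim: "limitin (sigma_topology Z F) f l sequentially" and \<phi>: "\<phi> \<in> F"
  show "(\<lambda>n. \<phi> (f n)) \<longlonglongrightarrow> \<phi> l"
  proof (rule topological_tendstoI)
    fix S assume "open S" "\<phi> l \<in> S"
    with lim openin_sigma_topology[OF \<phi> \<open>open S\<close>, of Z] l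
    have "\<forall>\<^sub>F n in sequentially. f n \<in> {z \<in> Z. \<phi> z \<in> S}"
      by (auto simp: limitin_def)
    then show "\<forall>\<^sub>F n in sequentially. \<phi> (f n) \<in> S"
      by (rule eventually_mono) simp
  qed
next
  assume conv: "\<forall>\<phi>\<in>F. (\<lambda>n. \<phi> (f n)) \<longlonglongrightarrow> \<phi> l"
  have ev: "l \<in> U \<longrightarrow> (\<forall>\<^sub>F n in sequentially. f n \<in> U)"
    if "generate_topology_on {{z \<in> Z. \<phi> z \<in> U} | \<phi> U. \<phi> \<in> F \<and> open U} U" for U
    using that
  proof induction
    case (UN K)
    show ?case
    proof
      assume "l \<in> \<Union> K"
      then obtain k where k: "k \<in> K" "l \<in> k" ..
      with UN have "\<forall>\<^sub>F n in sequentially. f n \<in> k" by blast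
      then show "\<forall>\<^sub>F n in sequentially. f n \<in> \<Union> K"
        by (rule eventually_mono) (use k in blast)
    qed
  next
    case (Basis s)
    then obtain \<phi> V where s: "s = {z \<in> Z. \<phi> z \<in> V}" "\<phi> \<in> F" "open V" by blast
    with conv have "\<phi> l \<in> V \<longrightarrow> (\<forall>\<^sub>F n in sequentially. \<phi> (f n) \<in> V)"
      by (auto dest: topological_tendstoD)
    moreover have "f n \<in> Z" for n using f by blast
    ultimately show ?case by (simp add: s(1))
  qed (auto intro: eventually_conj)
  show "limitin (sigma_topology Z F) f l sequentially"
    unfolding limitin_def topspace_sigma_topology[OF F]
    using ev l by (auto simp: sigma_topology_def openin_topology_generated_by_iff)
qed

section \<open>Cluster points and finite nets in weakly compact sets\<close>

text \<open>If no \<open>k\<close> worked, each point of \<open>K\<close> would have a neighbourhood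
  that the sequence eventually leaves, and a finite subcover would expel the sequence from
  \<open>K\<close>. A cluster point is all that is needed of weak compactness here; no subsequence
  is extracted.\<close>

lemma compactin_sigma_topology_cluster:
  fixes F :: "('z \<Rightarrow> 'k::t2_space) set"
  assumes K: "compactin (sigma_topology Z F) K" and d: "\<And>n::nat. d n \<in> K"
  obtains k where "k \<in> K" "\<And>\<phi> l. \<phi> \<in> F \<Longrightarrow> (\<lambda>n. \<phi> (d n)) \<longlonglongrightarrow> l \<Longrightarrow> \<phi> k = l"
proof (rule ccontr)
  note witness = that
  assume contr: "\<not> thesis"
  have KZ: "K \<subseteq> Z"
  proof -
    have "K \<subseteq> topspace (sigma_topology Z F)"
      using K by (simp add: compactin_subset_topspace)
    then show ?thesis
      unfolding sigma_topology_def topology_generated_by_topspace by auto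
  qed
  have "\<exists>U. openin (sigma_topology Z F) U \<and> k \<in> U \<and> (\<forall>\<^sub>F n in sequentially. d n \<notin> U)"
    if "k \<in> K" for k
  proof -
    from contr that obtain \<phi> l where \<phi>: "\<phi> \<in> F" "(\<lambda>n. \<phi> (d n)) \<longlonglongrightarrow> l" "\<phi> k \<noteq> l"
      using witness by blast
    then obtain V W where "open V" "open W" "\<phi> k \<in> V" "l \<in> W" "V \<inter> W = {}"
      by (meson hausdorff)
    moreover from this \<phi> have "\<forall>\<^sub>F n in sequentially. \<phi> (d n) \<in> W"
      by (blast dest: topological_tendstoD)
    ultimately show ?thesis
      using openin_sigma_topology[OF \<phi>(1), of V Z] that KZ
      by (intro exI[of _ "{z \<in> Z. \<phi> z \<in> V}"]) (auto elim: eventually_mono)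
  qed
  then obtain U where U: "\<And>k. k \<in> K \<Longrightarrow> openin (sigma_topology Z F) (U k)"
      "\<And>k. k \<in> K \<Longrightarrow> k \<in> U k" "\<And>k. k \<in> K \<Longrightarrow> \<forall>\<^sub>F n in sequentially. d n \<notin> U k"
    by metis
  have "\<exists>\<F>. finite \<F> \<and> \<F> \<subseteq> U ` K \<and> K \<subseteq> \<Union> \<F>"
    using U(1,2) by (intro compactinD[OF K]) auto
  then obtain D where D: "finite D" "D \<subseteq> K" "K \<subseteq> (\<Union>k\<in>D. U k)"
    by (metis finite_subset_image)
  then have "\<forall>\<^sub>F n in sequentially. \<forall>k\<in>D. d n \<notin> U k"
    using U(3) by (intro eventually_ball_finite) auto
  then obtain n where "\<forall>k\<in>D. d n \<notin> U k"
    using eventually_happens' sequentially_bot by blast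
  with D d[of n] show False by blast
qed

text \<open>Finitely many functionals with a common tolerance define open neighbourhoods; the
  centres of a finite subcover form the net.\<close>

lemma compactin_sigma_topology_net:
  fixes F :: "('z \<Rightarrow> 'k::metric_space) set"
  assumes K: "compactin (sigma_topology Z F) K" and H: "finite H" "H \<subseteq> F" and e: "0 < e"
  shows "\<exists>D. finite D \<and> D \<subseteq> K \<and> (\<forall>k\<in>K. \<exists>d\<in>D. \<forall>h\<in>H. dist (h d) (h k) < e)"
proof -
  have KZ: "K \<subseteq> topspace (sigma_topology Z F)"
    using K by (simp add: compactin_subset_topspace)
  have top: "topspace (sigma_topology Z F) \<subseteq> Z"
    unfolding sigma_topology_def topology_generated_by_topspace by auto
  define U where "U k = {z \<in> topspace (sigma_topology Z F). \<forall>h\<in>H. dist (h k) (h z) < e}" for k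
  have "openin (sigma_topology Z F) (U k)" for k
    unfolding U_def using H
  proof induction
    case (insert h H)
    have "{z \<in> topspace (sigma_topology Z F). \<forall>g\<in>insert h H. dist (g k) (g z) < e} =
        {z \<in> Z. h z \<in> ball (h k) e} \<inter> {z \<in> topspace (sigma_topology Z F). \<forall>g\<in>H. dist (g k) (g z) < e}"
      using top by auto
    moreover have "openin (sigma_topology Z F) {z \<in> Z. h z \<in> ball (h k) e}"
      using insert.prems by (intro openin_sigma_topology) auto
    ultimately show ?case
      using insert by (auto intro: openin_Int)
  qed simp
  moreover have "k \<in> U k" if "k \<in> K" for k
    using that KZ e by (auto simp: U_def)
  ultimately have "\<exists>\<F>. finite \<F> \<and> \<F> \<subseteq> U ` K \<and> K \<subseteq> \<Union> \<F>"
    by (intro compactinD[OF K]) auto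
  then obtain D where D: "finite D" "D \<subseteq> K" "K \<subseteq> (\<Union>k\<in>D. U k)"
    by (metis finite_subset_image)
  have "\<exists>d\<in>D. \<forall>h\<in>H. dist (h d) (h k) < e" if "k \<in> K" for k
    using D(3) that by (auto simp: U_def)
  with D(1,2) show ?thesis by blast
qed

section \<open>Functionals on the dual\<close>

lemma functionals_on_subset: "Z \<subseteq> W \<Longrightarrow> functionals_on s W \<subseteq> functionals_on s Z"
  unfolding functionals_on_def by blast

lemma functionals_onD:
  assumes "\<phi> \<in> functionals_on s Z"
  shows "x \<in> Z \<Longrightarrow> y \<in> Z \<Longrightarrow> \<phi> (x + y) = \<phi> x + \<phi> y" "x \<in> Z \<Longrightarrow> \<phi> (s c x) = c * \<phi> x"
  using assms by (auto simp: functionals_on_def)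

lemma (in banach_over) linear_functional:
  assumes "\<phi> \<in> functionals_on scale UNIV"
  shows "linear \<phi>"
proof (rule linearI)
  show "\<phi> (x + y) = \<phi> x + \<phi> y" for x y
    using functionals_onD[OF assms] by simp
  show "\<phi> (r *\<^sub>R x) = r *\<^sub>R \<phi> x" for r x
    using functionals_onD(2)[OF assms, of x "of_real r"]
    by (simp add: scale_of_real scaleR_conv_of_real)
qed

lemma (in banach_over) scalar_ext_in_functionals_on:
  assumes "linear \<phi>" and le: "\<And>x. \<phi> x \<le> M * norm x"
  shows "scalar_ext scale \<phi> \<in> functionals_on scale UNIV"
    and "norm (scalar_ext scale \<phi> x) \<le> M * norm x"
proof -
  show bd: "norm (scalar_ext scale \<phi> x) \<le> M * norm x" for x
    by (intro norm_scalar_ext_le[OF assms(1)] order_trans[OF le]) (simp add: norm_scale)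
  then show "scalar_ext scale \<phi> \<in> functionals_on scale UNIV"
    using scalar_ext_add[OF assms(1)] scalar_ext_scale[OF assms(1)]
    by (auto simp: functionals_on_def)
qed

lemma dual_0: "0 \<in> dual s"
  and dual_add: "f \<in> dual s \<Longrightarrow> g \<in> dual s \<Longrightarrow> f + g \<in> dual s"
  and dual_diff: "f \<in> dual s \<Longrightarrow> g \<in> dual s \<Longrightarrow> f - g \<in> dual s"
  and dual_scaleR: "f \<in> dual s \<Longrightarrow> r *\<^sub>R f \<in> dual s"
  and dual_dual_scale: "f \<in> dual s \<Longrightarrow> dual_scale c f \<in> dual s"
  by (auto simp: dual_def blinfun.bilinear_simps dual_scale.rep_eq algebra_simps)

lemma dual_sum: "(\<And>i. i \<in> I \<Longrightarrow> f i \<in> dual s) \<Longrightarrow> (\<Sum>i\<in>I. f i) \<in> dual s"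
  by (induction I rule: infinite_finite_induct) (auto intro: dual_0 dual_add)

lemma evaluation_in_functionals_on: "(\<lambda>f. blinfun_apply f y) \<in> functionals_on dual_scale Z"
proof -
  have "norm (blinfun_apply f y) \<le> norm y * norm f" for f
    using norm_blinfun[of f y] by (simp add: mult.commute)
  then show ?thesis
    by (auto simp: functionals_on_def blinfun.bilinear_simps dual_scale.rep_eq)
qed

section \<open>Goldstine's theorem\<close>

text \<open>Each nonzero vector can be rotated and rescaled to norm \<open>M\<close> with its value
  under \<open>g\<close> nonnegative real, so real parts on the ball of radius \<open>M\<close>
  control the dual norm.\<close>

lemma (in banach_over) norm_dual_le:
  assumes g: "g \<in> dual scale" and M: "0 < M"
    and le: "\<And>y. norm y \<le> M \<Longrightarrow> real_part (blinfun_apply g y) \<le> b"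
  shows "M * norm g \<le> b"
proof -
  have b: "0 \<le> b"
    using le[of 0] M by (simp add: blinfun.zero_right)
  have "norm g \<le> b / M"
  proof (rule norm_blinfun_bound)
    show "0 \<le> b / M" using b M by simp
    fix x
    show "norm (blinfun_apply g x) \<le> b / M * norm x"
    proof (cases "x = 0")
      case False
      obtain c where c: "norm c = 1" "real_part (c * blinfun_apply g x) = norm (blinfun_apply g x)"
        by (rule scalar_rotate)
      let ?y = "(M / norm x) *\<^sub>R scale c x"
      have "norm ?y \<le> M"
        using M False c by (simp add: norm_scale)
      then have "M / norm x * norm (blinfun_apply g x) \<le> b"
        using le[of ?y] g c by (simp add: dual_def blinfun.bilinear_simps real_part_scaleR)
      then show ?thesis
        using M False by (simp add: field_simps)
    qed simp
  qed
  then show ?thesis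
    using M by (simp add: field_simps)
qed

text \<open>Goldstine's theorem by least squares: at a near-minimizer \<open>y\<^sub>0\<close> of the squared error over the
  ball, the functional whose coefficients are the residuals nearly attains its supremum over the
  ball at \<open>y\<^sub>0\<close>, while \<open>\<Phi>\<close> exceeds its value at \<open>y\<^sub>0\<close> by exactly the squared error.\<close>

lemma goldstine_real_part:
  fixes s :: "'k::real_or_complex \<Rightarrow> 'y::banach \<Rightarrow> 'y"
  assumes s: "banach_over s" and \<Phi>: "\<Phi> \<in> functionals_on dual_scale UNIV"
    and bound: "\<And>f. norm (\<Phi> f) \<le> M * norm f" and M: "0 < M"
    and G: "finite G" "G \<subseteq> dual s" and e: "0 < e"
  shows "\<exists>y. norm y \<le> M \<and> (\<forall>f\<in>G. \<bar>real_part (blinfun_apply f y - \<Phi> f)\<bar> < e)"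
proof -
  interpret D: banach_over "dual_scale :: 'k \<Rightarrow> ('y \<Rightarrow>\<^sub>L 'k) \<Rightarrow> _"
    by (rule banach_over_dual_scale)
  have lin: "linear \<Phi>"
    using \<Phi> by (rule D.linear_functional)
  define S where "S y = (\<Sum>f\<in>G. (real_part (blinfun_apply f y - \<Phi> f))\<^sup>2)" for y
  \<comment> \<open>This bounds the quadratic term below: two points of the ball are at distance at
    most \<open>2 * M\<close>.\<close>
  define Q where "Q = (\<Sum>f\<in>G. (2 * M * norm f)\<^sup>2)"
  define m where "m = (INF y\<in>cball 0 M. S y)"
  have S0: "0 \<le> S y" for y unfolding S_def by (intro sum_nonneg) simp
  have Q0: "0 \<le> Q" unfolding Q_def by (intro sum_nonneg) simp
  have bdd: "bdd_below (S ` cball 0 M)"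
    using S0 by (intro bdd_belowI2[of _ 0])
  have ne: "cball (0::'y) M \<noteq> {}"
    using M by simp
  have m_le: "m \<le> S y" if "norm y \<le> M" for y
    unfolding m_def using bdd that by (intro cINF_lower) auto
  have near: "\<exists>y. norm y \<le> M \<and> S y < b" if "m < b" for b
    using that unfolding m_def cINF_less_iff[OF ne bdd] by auto
  \<comment> \<open>The step from \<open>y0\<close> towards \<open>y\<close> has length factor
    \<open>t\<close> and the minimum is approximated within \<open>t\<^sup>2\<close>. Tolerance and
    quadratic term are then both of order \<open>t\<^sup>2\<close>, and division by
    \<open>2 * t\<close> leaves an error of order \<open>t\<close>.\<close>
  have key: "m \<le> t * ((1 + Q) / 2)" if t: "0 < t" "t \<le> 1" for t
  proof -
    obtain y0 where y0: "norm y0 \<le> M" "S y0 < m + t\<^sup>2"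
      using near[of "m + t\<^sup>2"] t by auto
    define a where "a f = real_part (\<Phi> f - blinfun_apply f y0)" for f
    define g where "g = (\<Sum>f\<in>G. a f *\<^sub>R f)"
    have g: "g \<in> dual s"
      unfolding g_def using G by (intro dual_sum dual_scaleR) auto
    have gy: "real_part (blinfun_apply g y) = (\<Sum>f\<in>G. a f * real_part (blinfun_apply f y))" for y
      by (simp add: g_def blinfun.sum_left blinfun.scaleR_left real_part_sum real_part_scaleR)
    have "M * norm g \<le> real_part (blinfun_apply g y0) + t * ((1 + Q) / 2)"
    proof (rule banach_over.norm_dual_le[OF s g M])
      fix y :: 'y assume y: "norm y \<le> M"
      define r where "r f = real_part (blinfun_apply f (y - y0))" for f :: "'y \<Rightarrow>\<^sub>L 'k"
      let ?z = "y0 + t *\<^sub>R (y - y0)"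
      have "?z = (1 - t) *\<^sub>R y0 + t *\<^sub>R y"
        by (simp add: algebra_simps)
      moreover have "(1 - t) *\<^sub>R y0 + t *\<^sub>R y \<in> cball 0 M"
        using t y y0 by (intro convexD[OF convex_cball]) auto
      ultimately have "m \<le> S ?z"
        by (intro m_le) simp
      also have "S ?z = (\<Sum>f\<in>G. (t * r f - a f)\<^sup>2)"
        by (simp add: S_def r_def a_def blinfun.bilinear_simps real_part_add real_part_diff
            real_part_scaleR algebra_simps)
      also have "\<dots> = (\<Sum>f\<in>G. (a f)\<^sup>2 - 2 * t * (a f * r f) + t\<^sup>2 * (r f)\<^sup>2)"
        by (intro sum.cong refl) (simp add: power2_eq_square algebra_simps)
      also have "\<dots> = (\<Sum>f\<in>G. (a f)\<^sup>2) - 2 * t * (\<Sum>f\<in>G. a f * r f) + t\<^sup>2 * (\<Sum>f\<in>G. (r f)\<^sup>2)"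
        by (simp add: sum.distrib sum_subtractf sum_distrib_left)
      also have "(\<Sum>f\<in>G. (a f)\<^sup>2) = S y0"
        unfolding S_def by (intro sum.cong refl) (simp add: a_def real_part_diff power2_commute)
      also have "(\<Sum>f\<in>G. a f * r f) = real_part (blinfun_apply g y) - real_part (blinfun_apply g y0)"
        by (simp add: gy r_def blinfun.diff_right real_part_diff right_diff_distrib sum_subtractf)
      finally have 1: "m \<le> S y0 - 2 * t * (real_part (blinfun_apply g y) - real_part (blinfun_apply g y0))
          + t\<^sup>2 * (\<Sum>f\<in>G. (r f)\<^sup>2)" .
      have "(\<Sum>f\<in>G. (r f)\<^sup>2) \<le> Q"
        unfolding Q_def
      proof (rule sum_mono)
        fix f :: "'y \<Rightarrow>\<^sub>L 'k"
        have "norm (y - y0) \<le> 2 * M"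
          using norm_triangle_ineq4[of y y0] y y0 by simp
        then have "norm f * norm (y - y0) \<le> norm f * (2 * M)"
          by (intro mult_left_mono) auto
        then have "\<bar>r f\<bar> \<le> 2 * M * norm f"
          using real_part_le[of "blinfun_apply f (y - y0)"] norm_blinfun[of f "y - y0"]
          by (simp add: r_def algebra_simps)
        then show "(r f)\<^sup>2 \<le> (2 * M * norm f)\<^sup>2"
          by (metis abs_ge_zero power2_abs power_mono)
      qed
      then have "t\<^sup>2 * (\<Sum>f\<in>G. (r f)\<^sup>2) \<le> t\<^sup>2 * Q"
        by (intro mult_left_mono) auto
      with 1 y0(2) have "t * (2 * (real_part (blinfun_apply g y) - real_part (blinfun_apply g y0)))
          \<le> t * (t * (1 + Q))"
        by (simp add: power2_eq_square algebra_simps)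
      then have "2 * (real_part (blinfun_apply g y) - real_part (blinfun_apply g y0)) \<le> t * (1 + Q)"
        using t by simp
      then show "real_part (blinfun_apply g y) \<le> real_part (blinfun_apply g y0) + t * ((1 + Q) / 2)"
        by simp
    qed
    moreover have "real_part (\<Phi> g) \<le> M * norm g"
      using real_part_le[of "\<Phi> g"] bound[of g] by simp
    moreover have "real_part (\<Phi> g) - real_part (blinfun_apply g y0) = S y0"
    proof -
      have "real_part (\<Phi> g) = (\<Sum>f\<in>G. a f * real_part (\<Phi> f))"
        by (simp add: g_def linear_sum[OF lin] linear_scale[OF lin] real_part_sum real_part_scaleR)
      then have "real_part (\<Phi> g) - real_part (blinfun_apply g y0) = (\<Sum>f\<in>G. a f * a f)"
        by (simp add: gy a_def real_part_diff right_diff_distrib flip: sum_subtractf)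
      also have "\<dots> = S y0"
        unfolding S_def
        by (intro sum.cong refl) (simp add: a_def real_part_diff power2_eq_square algebra_simps)
      finally show ?thesis .
    qed
    ultimately show ?thesis
      using m_le[OF y0(1)] by linarith
  qed
  have "m \<le> 0"
  proof (rule ccontr)
    assume "\<not> m \<le> 0"
    then have m: "0 < m" by simp
    \<comment> \<open>With this \<open>t\<close> the estimate \<open>key\<close> yields
      \<open>m \<le> m / 2\<close>.\<close>
    define t where "t = min 1 (m / (1 + Q))"
    have "0 < t" "t \<le> 1" using m Q0 by (auto simp: t_def)
    from key[OF this] have "m \<le> t * (1 + Q) / 2" by simp
    moreover have "t * (1 + Q) \<le> m / (1 + Q) * (1 + Q)"
      using Q0 by (intro mult_right_mono) (auto simp: t_def)
    ultimately show False using m Q0 by simp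
  qed
  also have "0 < e\<^sup>2" using e by simp
  finally obtain y where y: "norm y \<le> M" "S y < e\<^sup>2"
    using near by blast
  have "\<bar>real_part (blinfun_apply f y - \<Phi> f)\<bar> < e" if "f \<in> G" for f
  proof -
    have "(real_part (blinfun_apply f y - \<Phi> f))\<^sup>2 \<le> S y"
      unfolding S_def using G that by (intro member_le_sum) auto
    with y(2) have "\<bar>real_part (blinfun_apply f y - \<Phi> f)\<bar>\<^sup>2 < e\<^sup>2" by simp
    then show ?thesis
      using e by (rule power2_less_imp_less[OF _ less_imp_le])
  qed
  with y(1) show ?thesis by blast
qed

text \<open>Adjoining the multiples of \<open>F\<close> by \<open>imag_unit\<close> controls both
  coordinates of the error; the tolerance \<open>e / (1 + norm imag_unit)\<close> is what
  \<open>norm_le_real_parts\<close> turns into \<open>e\<close>.\<close>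

lemma goldstine:
  fixes s :: "'k::real_or_complex \<Rightarrow> 'y::banach \<Rightarrow> 'y"
  assumes s: "banach_over s" and \<Phi>: "\<Phi> \<in> functionals_on dual_scale UNIV"
    and bound: "\<And>f. norm (\<Phi> f) \<le> M * norm f" and M: "0 < M"
    and F: "finite F" "F \<subseteq> dual s" and e: "0 < e"
  shows "\<exists>y. norm y \<le> M \<and> (\<forall>f\<in>F. norm (blinfun_apply f y - \<Phi> f) < e)"
proof -
  let ?j = "imag_unit :: 'k"
  let ?G = "F \<union> dual_scale ?j ` F"
  have "\<exists>y. norm y \<le> M \<and> (\<forall>f\<in>?G. \<bar>real_part (blinfun_apply f y - \<Phi> f)\<bar> < e / (1 + norm ?j))"
    using F e by (intro goldstine_real_part[OF s \<Phi> bound M])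
      (auto intro!: dual_dual_scale divide_pos_pos add_pos_nonneg)
  then obtain y where y: "norm y \<le> M"
    "\<And>f. f \<in> ?G \<Longrightarrow> \<bar>real_part (blinfun_apply f y - \<Phi> f)\<bar> < e / (1 + norm ?j)"
    by blast
  have "norm (blinfun_apply f y - \<Phi> f) < e" if "f \<in> F" for f
  proof -
    let ?z = "blinfun_apply f y - \<Phi> f" and ?d = "e / (1 + norm ?j)"
    have "blinfun_apply (dual_scale ?j f) y - \<Phi> (dual_scale ?j f) = ?j * ?z"
      using functionals_onD(2)[OF \<Phi>] by (simp add: dual_scale.rep_eq right_diff_distrib)
    then have 2: "\<bar>real_part (?j * ?z)\<bar> \<le> ?d"
      using y(2)[of "dual_scale ?j f"] that by simp
    have "norm ?z \<le> \<bar>real_part ?z\<bar> + norm ?j * \<bar>real_part (?j * ?z)\<bar>"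
      by (rule norm_le_real_parts)
    also have "\<dots> < ?d + norm ?j * ?d"
      using y(2)[of f] that by (intro add_less_le_mono mult_left_mono 2) auto
    also have "\<dots> = (1 + norm ?j) * ?d"
      by (simp only: distrib_right mult_1)
    also have "\<dots> = e"
      using norm_ge_zero[of ?j] by (simp add: add_nonneg_eq_0_iff)
    finally show ?thesis .
  qed
  with y(1) show ?thesis by blast
qed

section \<open>Sequential approximation over a weakly compactly generated dual\<close>

text \<open>A Banach limit along a bounded sequence, chosen large at a given functional \<open>g\<close>.\<close>

lemma bounded_sequence_limit_functional:
  fixes y :: "nat \<Rightarrow> 'y::real_normed_vector" and g :: "'y \<Rightarrow>\<^sub>L 'k::real_or_complex"
  assumes y_le: "\<And>n. norm (y n) \<le> M"
    and freq: "\<exists>\<^sub>F n in sequentially. b \<le> real_part (blinfun_apply g (y n))"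
  shows "\<exists>\<psi>. linear \<psi> \<and> (\<forall>f. \<psi> f \<le> M * norm f) \<and> b \<le> \<psi> g \<and>
    (\<forall>f e. (\<forall>\<^sub>F n in sequentially. real_part (blinfun_apply f (y n)) \<le> e) \<longrightarrow> \<psi> f \<le> e)"
proof -
  \<comment> \<open>The part with \<open>f\<close> and \<open>e\<close> makes every eventual upper
    bound along \<open>y\<close> an upper bound for \<open>\<psi> f\<close>; the part with
    \<open>t\<close> encodes \<open>b \<le> \<psi> g\<close>.\<close>
  define G where "G = {(f - t *\<^sub>R g, e - t * b) | f t e.
      0 \<le> t \<and> (\<forall>\<^sub>F n in sequentially. real_part (blinfun_apply f (y n)) \<le> e)}"
  have GI: "(f - t *\<^sub>R g, e - t * b) \<in> G"
    if "0 \<le> t" "\<forall>\<^sub>F n in sequentially. real_part (blinfun_apply f (y n)) \<le> e" for f t e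
    using that unfolding G_def by blast
  have GE: "\<exists>f t e. v = f - t *\<^sub>R g \<and> p = e - t * b \<and> 0 \<le> t \<and>
      (\<forall>\<^sub>F n in sequentially. real_part (blinfun_apply f (y n)) \<le> e)" if "(v, p) \<in> G" for v p
    using that by (simp add: G_def)
  have "\<exists>\<psi>. linear \<psi> \<and> (\<forall>f. \<psi> f \<le> M * norm f) \<and> (\<forall>v c. (v, c) \<in> G \<longrightarrow> \<psi> v \<le> c)"
  proof (rule hahn_banach_cone)
    show "sublinear (\<lambda>f::'y \<Rightarrow>\<^sub>L 'k. M * norm f)"
      using order_trans[OF norm_ge_zero y_le] by (rule sublinear_norm)
    show "(0, 0) \<in> G"
      using GI[of 0 0 0] by simp
    show "(v + w, p + q) \<in> G" if vw: "(v, p) \<in> G" "(w, q) \<in> G" for v p w q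
    proof -
      obtain f t e where 1: "v = f - t *\<^sub>R g" "p = e - t * b" "0 \<le> t"
        "\<forall>\<^sub>F n in sequentially. real_part (blinfun_apply f (y n)) \<le> e"
        using GE[OF vw(1)] by blast
      obtain h r d where 2: "w = h - r *\<^sub>R g" "q = d - r * b" "0 \<le> r"
        "\<forall>\<^sub>F n in sequentially. real_part (blinfun_apply h (y n)) \<le> d"
        using GE[OF vw(2)] by blast
      have "\<forall>\<^sub>F n in sequentially. real_part (blinfun_apply (f + h) (y n)) \<le> e + d"
        using 1(4) 2(4) by eventually_elim (simp add: blinfun.add_left real_part_add)
      from GI[OF add_nonneg_nonneg[OF 1(3) 2(3)] this] show ?thesis
        unfolding 1(1,2) 2(1,2) by (simp add: algebra_simps)
    qed
    show "(r *\<^sub>R v, r * p) \<in> G" if vp: "(v, p) \<in> G" and r: "0 < r" for v p r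
    proof -
      obtain f t e where 1: "v = f - t *\<^sub>R g" "p = e - t * b" "0 \<le> t"
        "\<forall>\<^sub>F n in sequentially. real_part (blinfun_apply f (y n)) \<le> e"
        using GE[OF vp] by blast
      have "\<forall>\<^sub>F n in sequentially. real_part (blinfun_apply (r *\<^sub>R f) (y n)) \<le> r * e"
        using 1(4) by eventually_elim (use r in \<open>simp add: blinfun.scaleR_left real_part_scaleR\<close>)
      from GI[OF mult_nonneg_nonneg[OF less_imp_le[OF r] 1(3)] this] show ?thesis
        unfolding 1(1,2) by (simp add: algebra_simps)
    qed
    show "0 \<le> M * norm (- v) + p" if vp: "(v, p) \<in> G" for v p
    proof -
      obtain f t e where 1: "v = f - t *\<^sub>R g" "p = e - t * b" "0 \<le> t"
        "\<forall>\<^sub>F n in sequentially. real_part (blinfun_apply f (y n)) \<le> e"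
        using GE[OF vp] by blast
      \<comment> \<open>Something frequent and something eventual hold together at one index;
        evaluation at that single \<open>y n\<close> proves the constraints consistent.\<close>
      obtain n where n: "b \<le> real_part (blinfun_apply g (y n))" "real_part (blinfun_apply f (y n)) \<le> e"
        using frequently_ex[OF frequently_eventually_conj[OF freq 1(4)]] by blast
      have "t * b - e \<le> real_part (blinfun_apply (- v) (y n))"
        using n(2) mult_left_mono[OF n(1) 1(3)]
        by (simp add: 1(1) blinfun.bilinear_simps real_part_diff real_part_scaleR)
      also have "\<dots> \<le> norm (- v) * norm (y n)"
        using real_part_le[of "blinfun_apply (- v) (y n)"] norm_blinfun[of "- v" "y n"] by linarith
      also have "\<dots> \<le> M * norm (- v)"
        using mult_left_mono[OF y_le norm_ge_zero] by (simp only: mult.commute[of M])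
      finally show ?thesis by (simp add: 1(2))
    qed
  qed
  then obtain \<psi> where \<psi>: "linear \<psi>" "\<And>f. \<psi> f \<le> M * norm f" "\<And>v p. (v, p) \<in> G \<Longrightarrow> \<psi> v \<le> p"
    by blast
  have "\<psi> (- g) \<le> - b"
    using GI[of 1 0 0] by (intro \<psi>(3)) simp
  then have "b \<le> \<psi> g"
    by (simp add: linear_neg[OF \<psi>(1)])
  moreover have "\<psi> f \<le> e" if "\<forall>\<^sub>F n in sequentially. real_part (blinfun_apply f (y n)) \<le> e" for f e
    using GI[OF order_refl that] by (intro \<psi>(3)) simp
  ultimately show ?thesis
    using \<psi>(1,2) by blast
qed

text \<open>The points \<open>y n\<close> and finite subsets \<open>D n\<close> of the generating set are chosen alternately, as in
  Whitley's proof of the Eberlein-Smulian theorem: \<open>D (n + 1)\<close> is a net for \<open>\<Phi>\<close> and the evaluations at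
  the earlier points, and \<open>y n\<close> approximates \<open>\<Phi>\<close> on it.\<close>

lemma goldstine_sequence:
  fixes s :: "'k::real_or_complex \<Rightarrow> 'y::banach \<Rightarrow> 'y"
  assumes s: "banach_over s" and wcg: "weakly_compactly_generated dual_scale (dual s)"
    and \<Phi>: "\<Phi> \<in> functionals_on dual_scale UNIV"
    and bound: "\<And>f. norm (\<Phi> f) \<le> M * norm f" and M: "0 < M"
  obtains y :: "nat \<Rightarrow> 'y" where "\<And>f. f \<in> dual s \<Longrightarrow> (\<lambda>n. blinfun_apply f (y n)) \<longlonglongrightarrow> \<Phi> f"
proof -
  interpret D: banach_over "dual_scale :: 'k \<Rightarrow> ('y \<Rightarrow>\<^sub>L 'k) \<Rightarrow> _"
    by (rule banach_over_dual_scale)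
  let ?F = "functionals_on dual_scale (dual s) :: (('y \<Rightarrow>\<^sub>L 'k) \<Rightarrow> 'k) set"
  let ?ev = "\<lambda>y f. blinfun_apply f y :: 'k"
  have lin: "linear \<Phi>"
    using \<Phi> by (rule D.linear_functional)
  have \<Phi>F: "\<Phi> \<in> ?F"
    using functionals_on_subset[of "dual s" UNIV] \<Phi> by blast
  obtain K where K: "compactin (sigma_topology (dual s) ?F) K" and span: "closure (D.span K) = dual s"
    using wcg unfolding weakly_compactly_generated_def weak_topology_def by blast
  have "?F \<noteq> {}" using \<Phi>F by blast
  then have Kdual: "K \<subseteq> dual s"
    using compactin_subset_topspace[OF K] by (simp add: topspace_sigma_topology)
  \<comment> \<open>A state consists of the finite subset of \<open>K\<close>, the finite set of
    points found so far and the latest point. The initial third component \<open>0\<close> is a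
    placeholder.\<close>
  have "\<exists>x. \<forall>n. (finite (fst (x n)) \<and> fst (x n) \<subseteq> K \<and> finite (fst (snd (x n))) \<and> norm (snd (snd (x n))) \<le> M) \<and>
      (fst (x n) \<subseteq> fst (x (Suc n)) \<and>
       fst (snd (x (Suc n))) = insert (snd (snd (x (Suc n)))) (fst (snd (x n))) \<and>
       (\<forall>k\<in>K. \<exists>d\<in>fst (x (Suc n)). \<forall>h\<in>insert \<Phi> (?ev ` fst (snd (x n))). dist (h d) (h k) < inverse (real (Suc n))) \<and>
       (\<forall>d\<in>fst (x (Suc n)). dist (blinfun_apply d (snd (snd (x (Suc n))))) (\<Phi> d) < inverse (real (Suc n))))"
  proof (rule dependent_nat_choice)
    show "\<exists>x. finite (fst x) \<and> fst x \<subseteq> K \<and> finite (fst (snd x)) \<and> norm (snd (snd x)) \<le> M"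
      using M by (intro exI[of _ "({}, {}, 0)"]) simp
    fix x :: "('y \<Rightarrow>\<^sub>L 'k) set \<times> 'y set \<times> 'y" and n :: nat
    assume x: "finite (fst x) \<and> fst x \<subseteq> K \<and> finite (fst (snd x)) \<and> norm (snd (snd x)) \<le> M"
    let ?H = "insert \<Phi> (?ev ` fst (snd x))" and ?e = "inverse (real (Suc n))"
    have H: "finite ?H" "?H \<subseteq> ?F" and e: "0 < ?e"
      using x \<Phi>F evaluation_in_functionals_on by auto
    obtain E where E: "finite E" "E \<subseteq> K" "\<And>k. k \<in> K \<Longrightarrow> \<exists>d\<in>E. \<forall>h\<in>?H. dist (h d) (h k) < ?e"
      using compactin_sigma_topology_net[OF K H e] by blast
    let ?E = "fst x \<union> E"
    have E': "finite ?E" "?E \<subseteq> dual s"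
      using x E Kdual by auto
    obtain y where y: "norm y \<le> M" "\<And>d. d \<in> ?E \<Longrightarrow> norm (blinfun_apply d y - \<Phi> d) < ?e"
      using goldstine[OF s \<Phi> bound M E' e] by blast
    show "\<exists>x'. (finite (fst x') \<and> fst x' \<subseteq> K \<and> finite (fst (snd x')) \<and> norm (snd (snd x')) \<le> M) \<and>
      (fst x \<subseteq> fst x' \<and> fst (snd x') = insert (snd (snd x')) (fst (snd x)) \<and>
       (\<forall>k\<in>K. \<exists>d\<in>fst x'. \<forall>h\<in>?H. dist (h d) (h k) < ?e) \<and>
       (\<forall>d\<in>fst x'. dist (blinfun_apply d (snd (snd x'))) (\<Phi> d) < ?e))"
    proof (rule exI[of _ "(?E, insert y (fst (snd x)), y)"], intro conjI ballI)
      show "\<exists>d\<in>fst (?E, insert y (fst (snd x)), y). \<forall>h\<in>?H. dist (h d) (h k) < ?e" if "k \<in> K" for k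
        unfolding fst_conv using E(3)[OF that] by blast
    qed (use x E y in \<open>auto simp: dist_norm\<close>)
  qed
  then obtain x where x: "\<And>n. fst (x n) \<subseteq> K" "\<And>n. norm (snd (snd (x n))) \<le> M"
    "\<And>n. fst (x n) \<subseteq> fst (x (Suc n))"
    "\<And>n. fst (snd (x (Suc n))) = insert (snd (snd (x (Suc n)))) (fst (snd (x n)))"
    "\<And>n k. k \<in> K \<Longrightarrow> \<exists>d\<in>fst (x (Suc n)). \<forall>h\<in>insert \<Phi> (?ev ` fst (snd (x n))). dist (h d) (h k) < inverse (real (Suc n))"
    "\<And>n d. d \<in> fst (x (Suc n)) \<Longrightarrow> dist (blinfun_apply d (snd (snd (x (Suc n))))) (\<Phi> d) < inverse (real (Suc n))"
    by blast
  define D where "D n = fst (x n)" for n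
  define A where "A n = fst (snd (x n))" for n
  \<comment> \<open>The index shift skips the placeholder, so \<open>y n\<close> approximates
    \<open>\<Phi>\<close> on \<open>D (Suc n)\<close> and \<open>A n\<close> contains the
    \<open>y i\<close> with \<open>i < n\<close>.\<close>
  define y where "y n = snd (snd (x (Suc n)))" for n
  have DK: "D n \<subseteq> K" and y_le: "norm (y n) \<le> M" and A_Suc: "A (Suc n) = insert (y n) (A n)" for n
    using x by (auto simp: D_def A_def y_def)
  have net: "\<exists>d\<in>D (Suc n). \<forall>h\<in>insert \<Phi> (?ev ` A n). dist (h d) (h k) < inverse (real (Suc n))"
    if "k \<in> K" for n k
    unfolding D_def A_def using x(5)[OF that] .
  have approx: "dist (blinfun_apply d (y n)) (\<Phi> d) < inverse (real (Suc n))" if "d \<in> D (Suc n)" for n d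
    using x(6) that by (simp add: D_def y_def)
  have D_mono: "D m \<subseteq> D n" if "m \<le> n" for m n
    by (rule lift_Suc_mono_le[OF _ that]) (unfold D_def, rule x(3))
  have yA: "y i \<in> A n" if "i < n" for i n
    using that by (induction n) (auto simp: A_Suc less_Suc_eq)
  have y_bound: "norm (blinfun_apply f (y n)) \<le> M * norm f" for f :: "'y \<Rightarrow>\<^sub>L 'k" and n
    using norm_blinfun[of f "y n"] mult_left_mono[OF y_le[of n], of "norm f"]
    by (simp add: mult.commute)
  have lim_inverse: "z \<longlonglongrightarrow> l" if "\<forall>\<^sub>F n in sequentially. dist (z n) l < inverse (real (Suc n))"
    for z :: "nat \<Rightarrow> 'k" and l
  proof -
    have "(\<lambda>n. dist (z n) l) \<longlonglongrightarrow> 0"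
      using that by (intro tendsto_sandwich[OF _ _ tendsto_const LIMSEQ_inverse_real_of_nat])
        (auto elim: eventually_mono)
    then show ?thesis by (rule tendsto_dist_iff[THEN iffD2])
  qed
  have lim_D: "(\<lambda>n. blinfun_apply d (y n)) \<longlonglongrightarrow> \<Phi> d" if "d \<in> D m" for d m
  proof (rule lim_inverse)
    have "dist (blinfun_apply d (y n)) (\<Phi> d) < inverse (real (Suc n))" if "m \<le> n" for n
      using D_mono[of m "Suc n"] \<open>d \<in> D m\<close> that by (intro approx) auto
    then show "\<forall>\<^sub>F n in sequentially. dist (blinfun_apply d (y n)) (\<Phi> d) < inverse (real (Suc n))"
      by (rule eventually_sequentiallyI)
  qed
  \<comment> \<open>Net points \<open>d n\<close> approximate \<open>k\<close> under
    \<open>\<Phi>\<close> and the earlier evaluations, so a weak cluster point \<open>k'\<close> of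
    them agrees with \<open>k\<close> at every \<open>y i\<close>. If convergence at
    \<open>k\<close> failed, a Banach limit \<open>\<Psi>\<close> along \<open>y\<close> would
    differ from \<open>\<Phi>\<close> at \<open>k\<close>; but \<open>\<Psi> k = \<Psi> k'\<close>,
    and \<open>\<Psi> k'\<close> is the limit of \<open>\<Psi> (d n) = \<Phi> (d n)\<close>, that is
    \<open>\<Phi> k\<close>.\<close>
  have lim_K: "(\<lambda>n. blinfun_apply k (y n)) \<longlonglongrightarrow> \<Phi> k" if k: "k \<in> K" for k
  proof -
    obtain d where d: "\<And>n. d n \<in> D (Suc n)"
      "\<And>n h. h \<in> insert \<Phi> (?ev ` A n) \<Longrightarrow> dist (h (d n)) (h k) < inverse (real (Suc n))"
      using net[OF k] by (metis (no_types, lifting))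
    have "d n \<in> K" for n using d(1) DK by blast
    then obtain k' where k': "k' \<in> K"
      "\<And>\<phi> l. \<phi> \<in> ?F \<Longrightarrow> (\<lambda>n. \<phi> (d n)) \<longlonglongrightarrow> l \<Longrightarrow> \<phi> k' = l"
      using compactin_sigma_topology_cluster[OF K, of d] by metis
    have \<Phi>d: "(\<lambda>n. \<Phi> (d n)) \<longlonglongrightarrow> \<Phi> k"
      using d(2) by (intro lim_inverse always_eventually) blast
    have k'y: "blinfun_apply k' (y i) = blinfun_apply k (y i)" for i
    proof (rule k'(2)[OF evaluation_in_functionals_on], rule lim_inverse)
      have "dist (blinfun_apply (d n) (y i)) (blinfun_apply k (y i)) < inverse (real (Suc n))"
        if "Suc i \<le> n" for n
        using d(2)[of "?ev (y i)" n] yA[of i n] that by auto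
      then show "\<forall>\<^sub>F n in sequentially.
          dist (blinfun_apply (d n) (y i)) (blinfun_apply k (y i)) < inverse (real (Suc n))"
        by (rule eventually_sequentiallyI)
    qed
    show ?thesis
    proof (rule tendsto_of_real_part)
      fix c b assume b: "real_part (c * \<Phi> k) < b"
      show "\<forall>\<^sub>F n in sequentially. real_part (c * blinfun_apply k (y n)) < b"
      proof (rule ccontr)
        assume "\<not> ?thesis"
        then have freq: "\<exists>\<^sub>F n in sequentially. b \<le> real_part (c * blinfun_apply k (y n))"
          by (simp add: frequently_def not_le)
        obtain \<psi> where \<psi>: "linear \<psi>" "\<And>f. \<psi> f \<le> M * norm f" "b \<le> \<psi> (dual_scale c k)"
            "\<And>f e. \<forall>\<^sub>F n in sequentially. real_part (blinfun_apply f (y n)) \<le> e \<Longrightarrow> \<psi> f \<le> e"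
          using bounded_sequence_limit_functional[of y M, OF y_le, of b "dual_scale c k"] freq
          unfolding dual_scale.rep_eq by blast
        define \<Psi> where "\<Psi> = scalar_ext dual_scale \<psi>"
        have \<Psi>: "\<Psi> \<in> functionals_on dual_scale UNIV"
          unfolding \<Psi>_def using \<psi>(1,2) by (rule D.scalar_ext_in_functionals_on)
        have re\<Psi>: "real_part (a * \<Psi> f) = \<psi> (dual_scale a f)" for a f
          unfolding \<Psi>_def by (metis D.scalar_ext_scale[OF \<psi>(1)] D.real_part_scalar_ext[OF \<psi>(1)])
        \<comment> \<open>The one-sided bounds on \<open>\<psi>\<close>, applied to all scalar
          multiples of \<open>f\<close>, force \<open>\<Psi>\<close> to return every genuine limit
          along \<open>y\<close>.\<close>
        have \<Psi>_lim: "\<Psi> f = l" if "(\<lambda>n. blinfun_apply f (y n)) \<longlonglongrightarrow> l" for f l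
        proof (rule scalar_eqI)
          fix a
          have lim: "(\<lambda>n. real_part (blinfun_apply (dual_scale a f) (y n))) \<longlonglongrightarrow> real_part (a * l)"
            unfolding dual_scale.rep_eq
            by (intro bounded_linear.tendsto[OF bounded_linear_real_part] tendsto_mult_left that)
          have "\<psi> (dual_scale a f) \<le> e" if "real_part (a * l) < e" for e
            using order_tendstoD(2)[OF lim that] by (intro \<psi>(4)) (auto elim: eventually_mono)
          then show "real_part (a * \<Psi> f) \<le> real_part (a * l)"
            unfolding re\<Psi> by (rule dense_ge)
        qed
        have "\<Psi> (k' - k) = 0"
          by (rule \<Psi>_lim) (simp add: blinfun.diff_left k'y)
        then have "\<Psi> k = \<Psi> k'"
          by (simp add: linear_diff[OF D.linear_functional[OF \<Psi>]])
        also have "\<Psi> k' = \<Phi> k"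
        proof (rule k'(2))
          show "\<Psi> \<in> ?F"
            using functionals_on_subset[of "dual s" UNIV] \<Psi> by blast
          show "(\<lambda>n. \<Psi> (d n)) \<longlonglongrightarrow> \<Phi> k"
            using \<Phi>d \<Psi>_lim[OF lim_D[OF d(1)]] by simp
        qed
        finally have "\<psi> (dual_scale c k) < b"
          using b re\<Psi>[of c k] by simp
        with \<psi>(3) show False by simp
      qed
    qed
  qed
  have lim_span: "(\<lambda>n. blinfun_apply f (y n)) \<longlonglongrightarrow> \<Phi> f" if "f \<in> D.span K" for f
    using that
  proof (rule D.span_induct)
    show "D.subspace {f. (\<lambda>n. blinfun_apply f (y n)) \<longlonglongrightarrow> \<Phi> f}"
      using functionals_onD[OF \<Phi>] linear_0[OF lin]
      by (auto simp: D.subspace_def blinfun.bilinear_simps dual_scale.rep_eq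
          intro!: tendsto_add tendsto_mult_left)
  qed (use lim_K in auto)
  have "(\<lambda>n. blinfun_apply f (y n)) \<longlonglongrightarrow> \<Phi> f" if "f \<in> dual s" for f
  proof (rule tendstoI)
    fix e :: real assume e: "0 < e"
    have "f \<in> closure (D.span K)"
      using that span by simp
    \<comment> \<open>The tolerance makes \<open>f - g\<close> contribute less than
      \<open>e / 3\<close> both at \<open>y n\<close>, uniformly in \<open>n\<close>, and under
      \<open>\<Phi>\<close>.\<close>
    then obtain g where g: "g \<in> D.span K" "dist g f < e / (3 * M)"
      using e M closure_approachable[of f "D.span K"] by (metis divide_pos_pos mult_pos_pos zero_less_numeral)
    have small: "M * norm (f - g) < e / 3"
      using g(2) M by (simp add: dist_norm norm_minus_commute field_simps)
    have "\<forall>\<^sub>F n in sequentially. dist (blinfun_apply g (y n)) (\<Phi> g) < e / 3"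
      using lim_span[OF g(1)] e by (intro tendstoD) auto
    then show "\<forall>\<^sub>F n in sequentially. dist (blinfun_apply f (y n)) (\<Phi> f) < e"
    proof eventually_elim
      case (elim n)
      have "blinfun_apply f (y n) - \<Phi> f =
          blinfun_apply (f - g) (y n) + ((blinfun_apply g (y n) - \<Phi> g) - \<Phi> (f - g))"
        by (simp add: blinfun.diff_left linear_diff[OF lin])
      also have "norm \<dots> \<le> norm (blinfun_apply (f - g) (y n)) +
          (norm (blinfun_apply g (y n) - \<Phi> g) + norm (\<Phi> (f - g)))"
        by (intro norm_triangle_mono norm_triangle_ineq4 order_refl)
      finally show ?case
        using elim y_bound[of "f - g" n] bound[of "f - g"] small by (simp add: dist_norm)
    qed
  qed
  then show ?thesis by (rule that)
qed

section \<open>Operators into dual spaces\<close>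

text \<open>The adjoint of \<open>T\<close> restricted to the canonical copy of \<open>'y\<close> in
  the bidual.\<close>

lift_definition preadjoint ::
    "('x::real_normed_vector \<Rightarrow>\<^sub>L ('y::real_normed_vector \<Rightarrow>\<^sub>L 'k::real_normed_vector)) \<Rightarrow> 'y \<Rightarrow> ('x \<Rightarrow>\<^sub>L 'k)"
  is "\<lambda>T y x. blinfun_apply (T x) y"
  by (rule bounded_linear_compose[OF blinfun.bounded_linear_left])

lemma preadjoint_add: "preadjoint T (y + z) = preadjoint T y + preadjoint T z"
  and preadjoint_scaleR: "preadjoint T (r *\<^sub>R y) = r *\<^sub>R preadjoint T y"
  and preadjoint_0: "preadjoint T 0 = 0"
  by (auto intro!: blinfun_eqI simp: preadjoint.rep_eq blinfun.bilinear_simps)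

lemma preadjoint_in_dual: "T \<in> operators_to_dual sX sY \<Longrightarrow> preadjoint T y \<in> dual sX"
  by (simp add: operators_to_dual_def dual_def preadjoint.rep_eq dual_scale.rep_eq)

lemma preadjoint_scale:
  "T \<in> operators_to_dual sX sY \<Longrightarrow> preadjoint T (sY c y) = dual_scale c (preadjoint T y)"
  by (auto intro!: blinfun_eqI simp: operators_to_dual_def dual_def preadjoint.rep_eq dual_scale.rep_eq)

text \<open>The bound holds at \<open>blinfun_apply T x\<close> for \<open>norm x \<le> 1\<close>,
  and evaluation at \<open>y\<close> is weak-star continuous, so it survives up to every
  \<open>e\<close> in the closure.\<close>

lemma weak_star_closure_image_le:
  assumes u: "u \<in> weak_star_topology sY closure_of (blinfun_apply T ` cball 0 1)"
  shows "norm (blinfun_apply u y) \<le> norm (preadjoint T y)"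
proof (rule field_le_epsilon)
  fix e :: real assume e: "0 < e"
  let ?U = "{f \<in> dual sY. blinfun_apply f y \<in> ball (blinfun_apply u y) e}"
  have "openin (weak_star_topology sY) ?U"
    unfolding weak_star_topology_def by (rule openin_sigma_topology) auto
  moreover have "u \<in> dual sY"
  proof -
    have "u \<in> topspace (weak_star_topology sY)"
      using u by (simp add: in_closure_of)
    then show ?thesis
      unfolding weak_star_topology_def by (subst (asm) topspace_sigma_topology) auto
  qed
  moreover have "\<forall>V. u \<in> V \<and> openin (weak_star_topology sY) V \<longrightarrow>
      (\<exists>f. f \<in> blinfun_apply T ` cball 0 1 \<and> f \<in> V)"
    using u unfolding in_closure_of by (rule conjunct2)
  ultimately have "\<exists>f. f \<in> blinfun_apply T ` cball 0 1 \<and> f \<in> ?U"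
    using e by (elim allE[of _ ?U]) simp
  then obtain x where x: "norm x \<le> 1" "blinfun_apply (blinfun_apply T x) y \<in> ball (blinfun_apply u y) e"
    by auto
  have "norm (blinfun_apply u y) \<le> norm (blinfun_apply (preadjoint T y) x) + e"
    using x(2) norm_triangle_sub[of "blinfun_apply u y" "blinfun_apply (preadjoint T y) x"]
    by (simp add: preadjoint.rep_eq dist_norm)
  also have "norm (blinfun_apply (preadjoint T y) x) \<le> norm (preadjoint T y) * norm x"
    by (rule norm_blinfun)
  also have "\<dots> \<le> norm (preadjoint T y)"
    using x(1) by (simp add: mult_left_le)
  finally show "norm (blinfun_apply u y) \<le> norm (preadjoint T y) + e" by simp
qed

section \<open>Separation and factorization by Hahn-Banach\<close>

text \<open>The positive distance of \<open>u\<close> from the image leaves room to enlarge the ball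
  to a radius \<open>r > 1\<close>; this gives the strict inequality at \<open>u\<close>.\<close>

lemma separation_from_ball_image:
  fixes T :: "'a::real_normed_vector \<Rightarrow>\<^sub>L 'b::real_normed_vector"
  assumes "u \<notin> closure (blinfun_apply T ` cball 0 1)"
  shows "\<exists>\<phi> M. linear \<phi> \<and> 0 < M \<and> (\<forall>f. \<phi> f \<le> M * norm f) \<and>
    (\<forall>x. \<phi> (blinfun_apply T x) \<le> norm x) \<and> 1 < \<phi> u"
proof -
  obtain \<delta> where \<delta>: "0 < \<delta>" "\<And>x. norm x \<le> 1 \<Longrightarrow> \<delta> \<le> dist (blinfun_apply T x) u"
    using assms unfolding closure_approachable by (force simp: not_less)
  \<comment> \<open>Here \<open>(r - 1) * norm u \<le> \<delta> / 2\<close>, so \<open>u\<close>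
    keeps distance \<open>\<delta> / 2\<close> from the image of the ball of radius
    \<open>r\<close>; \<open>M\<close> is chosen with \<open>M * (\<delta> / 2) = r\<close>.\<close>
  define r where "r = 1 + \<delta> / (2 * (1 + norm u))"
  define M where "M = 2 * r / \<delta>"
  have r: "1 < r"
    using \<delta>(1) by (simp add: r_def add_pos_nonneg)
  have M: "0 < M"
    using \<delta>(1) r by (simp add: M_def)
  have ru: "(r - 1) * norm u \<le> \<delta> / 2"
  proof -
    have "(r - 1) * norm u \<le> (r - 1) * (1 + norm u)"
      using r by (intro mult_left_mono) auto
    also have "\<dots> = \<delta> / 2"
      using norm_ge_zero[of u] by (simp add: r_def field_simps add_nonneg_eq_0_iff)
    finally show ?thesis .
  qed
  \<comment> \<open>This is the consistency condition for the cone below at \<open>t = 1\<close>;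
    homogeneity gives it for other positive \<open>t\<close>. For \<open>norm x > r\<close> the
    second summand alone suffices.\<close>
  have far: "r \<le> M * norm (u - blinfun_apply T x) + norm x" for x
  proof (cases "norm x \<le> r")
    case True
    have "\<delta> \<le> norm (inverse r *\<^sub>R blinfun_apply T x - u)"
      using \<delta>(2)[of "inverse r *\<^sub>R x"] True r by (simp add: dist_norm blinfun.scaleR_right field_simps)
    then have "r * \<delta> \<le> norm (r *\<^sub>R (inverse r *\<^sub>R blinfun_apply T x - u))"
      using r by simp
    also have "r *\<^sub>R (inverse r *\<^sub>R blinfun_apply T x - u) = (blinfun_apply T x - u) - (r - 1) *\<^sub>R u"
      using r by (simp add: algebra_simps)
    also have "norm \<dots> \<le> norm (blinfun_apply T x - u) + norm ((r - 1) *\<^sub>R u)"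
      by (rule norm_triangle_ineq4)
    also have "norm ((r - 1) *\<^sub>R u) \<le> \<delta> / 2"
      using ru r by simp
    finally have "r * \<delta> - \<delta> / 2 \<le> norm (u - blinfun_apply T x)"
      by (simp add: norm_minus_commute)
    moreover have "\<delta> * 1 \<le> \<delta> * r"
      using \<delta>(1) r by (intro mult_left_mono) auto
    ultimately have "\<delta> / 2 \<le> norm (u - blinfun_apply T x)"
      by (simp add: mult.commute)
    then have "M * (\<delta> / 2) \<le> M * norm (u - blinfun_apply T x)"
      using M by (intro mult_left_mono) auto
    moreover have "M * (\<delta> / 2) = r"
      using \<delta>(1) by (simp add: M_def)
    ultimately show ?thesis
      using norm_ge_zero[of x] by linarith
  next
    case False
    moreover have "0 \<le> M * norm (u - blinfun_apply T x)" using M by simp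
    ultimately show ?thesis by linarith
  qed
  \<comment> \<open>The cone combines the constraints
    \<open>\<phi> (blinfun_apply T x) \<le> norm x\<close> and
    \<open>r \<le> \<phi> u\<close>.\<close>
  define G where "G = {(blinfun_apply T x - t *\<^sub>R u, e - t * r) | x t e. 0 \<le> t \<and> norm x \<le> e}"
  have GI: "(blinfun_apply T x - t *\<^sub>R u, e - t * r) \<in> G" if "0 \<le> t" "norm x \<le> e" for x t e
    using that unfolding G_def by blast
  have GE: "\<exists>x t e. v = blinfun_apply T x - t *\<^sub>R u \<and> c = e - t * r \<and> 0 \<le> t \<and> norm x \<le> e"
    if "(v, c) \<in> G" for v c
    using that by (simp add: G_def)
  have "\<exists>\<phi>. linear \<phi> \<and> (\<forall>f. \<phi> f \<le> M * norm f) \<and> (\<forall>v c. (v, c) \<in> G \<longrightarrow> \<phi> v \<le> c)"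
  proof (rule hahn_banach_cone)
    show "sublinear (\<lambda>f::'b. M * norm f)"
      using M by (intro sublinear_norm) simp
    show "(0, 0) \<in> G"
      using GI[of 0 0 0] by (simp add: blinfun.zero_right)
    show "(v + w, c + d) \<in> G" if vw: "(v, c) \<in> G" "(w, d) \<in> G" for v c w d
    proof -
      obtain x t e where 1: "v = blinfun_apply T x - t *\<^sub>R u" "c = e - t * r" "0 \<le> t" "norm x \<le> e"
        using GE[OF vw(1)] by blast
      obtain y q p where 2: "w = blinfun_apply T y - q *\<^sub>R u" "d = p - q * r" "0 \<le> q" "norm y \<le> p"
        using GE[OF vw(2)] by blast
      from GI[OF add_nonneg_nonneg[OF 1(3) 2(3)] norm_triangle_mono[OF 1(4) 2(4)]] show ?thesis
        unfolding 1(1,2) 2(1,2) by (simp add: blinfun.add_right algebra_simps)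
    qed
    show "(a *\<^sub>R v, a * c) \<in> G" if vc: "(v, c) \<in> G" and a: "0 < a" for v c a
    proof -
      obtain x t e where 1: "v = blinfun_apply T x - t *\<^sub>R u" "c = e - t * r" "0 \<le> t" "norm x \<le> e"
        using GE[OF vc] by blast
      have "norm (a *\<^sub>R x) \<le> a * e"
        using 1(4) a by simp
      from GI[OF mult_nonneg_nonneg[OF less_imp_le[OF a] 1(3)] this] show ?thesis
        unfolding 1(1,2) by (simp add: blinfun.scaleR_right algebra_simps)
    qed
    show "0 \<le> M * norm (- v) + c" if vc: "(v, c) \<in> G" for v c
    proof -
      obtain x t e where 1: "v = blinfun_apply T x - t *\<^sub>R u" "c = e - t * r" "0 \<le> t" "norm x \<le> e"
        using GE[OF vc] by blast
      have "t * r \<le> M * norm (t *\<^sub>R u - blinfun_apply T x) + norm x"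
      proof (cases "t = 0")
        case True
        then show ?thesis using M by simp
      next
        case False
        with 1(3) have t: "0 < t" by simp
        have "t * r \<le> t * (M * norm (u - blinfun_apply T (inverse t *\<^sub>R x)) + norm (inverse t *\<^sub>R x))"
          using t by (intro mult_left_mono far) simp
        also have "\<dots> = M * norm (t *\<^sub>R (u - blinfun_apply T (inverse t *\<^sub>R x))) + norm x"
          using t by (simp add: distrib_left mult.left_commute[of t M])
        also have "t *\<^sub>R (u - blinfun_apply T (inverse t *\<^sub>R x)) = t *\<^sub>R u - blinfun_apply T x"
          using t by (simp add: blinfun.scaleR_right scaleR_diff_right)
        finally show ?thesis .
      qed
      with 1 show ?thesis by simp
    qed
  qed
  then obtain \<phi> where \<phi>: "linear \<phi>" "\<And>f. \<phi> f \<le> M * norm f" "\<And>v c. (v, c) \<in> G \<Longrightarrow> \<phi> v \<le> c"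
    by blast
  have "\<phi> (blinfun_apply T x) \<le> norm x" for x
    using GI[of 0 x "norm x"] by (intro \<phi>(3)) simp
  moreover have "\<phi> (- u) \<le> - r"
    using GI[of 1 0 0] by (intro \<phi>(3)) (simp add: blinfun.zero_right)
  ultimately show ?thesis
    using \<phi>(1,2) M r by (intro exI[of _ \<phi>] exI[of _ M]) (auto simp: linear_neg[OF \<phi>(1)])
qed

text \<open>The bound \<open>le\<close> says that sending \<open>preadjoint T y\<close> to
  \<open>blinfun_apply u y\<close> is well defined and contractive on the range of
  \<open>preadjoint T\<close>. Hahn-Banach with the graph of its real part as cone extends it with
  norm at most 1.\<close>

lemma factor_through_preadjoint:
  fixes sX :: "'k::real_or_complex \<Rightarrow> 'x::banach \<Rightarrow> 'x" and sY :: "'k \<Rightarrow> 'y::banach \<Rightarrow> 'y"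
  assumes T: "T \<in> operators_to_dual sX sY" and u: "u \<in> dual sY"
    and le: "\<And>y. norm (blinfun_apply u y) \<le> norm (preadjoint T y)"
  shows "\<exists>\<Psi>\<in>functionals_on dual_scale UNIV. (\<forall>f. norm (\<Psi> f) \<le> norm f) \<and>
    (\<forall>y. \<Psi> (preadjoint T y) = blinfun_apply u y)"
proof -
  interpret D: banach_over "dual_scale :: 'k \<Rightarrow> ('x \<Rightarrow>\<^sub>L 'k) \<Rightarrow> _"
    by (rule banach_over_dual_scale)
  define G where "G = range (\<lambda>y. (preadjoint T y, real_part (blinfun_apply u y)))"
  have GI: "(preadjoint T y, real_part (blinfun_apply u y)) \<in> G" for y
    unfolding G_def by blast
  have "\<exists>\<psi>. linear \<psi> \<and> (\<forall>f. \<psi> f \<le> 1 * norm f) \<and> (\<forall>v c. (v, c) \<in> G \<longrightarrow> \<psi> v \<le> c)"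
  proof (rule hahn_banach_cone)
    show "sublinear (\<lambda>f::'x \<Rightarrow>\<^sub>L 'k. 1 * norm f)"
      by (rule sublinear_norm) simp
    show "(0, 0) \<in> G"
      using GI[of 0] by (simp add: preadjoint_0 blinfun.zero_right)
    show "(v + w, c + d) \<in> G" if "(v, c) \<in> G" "(w, d) \<in> G" for v c w d
    proof -
      from that obtain y z where "v = preadjoint T y" "c = real_part (blinfun_apply u y)"
        "w = preadjoint T z" "d = real_part (blinfun_apply u z)"
        unfolding G_def by blast
      with GI[of "y + z"] show ?thesis
        by (simp add: preadjoint_add blinfun.add_right real_part_add)
    qed
    show "(r *\<^sub>R v, r * c) \<in> G" if "(v, c) \<in> G" for v c r
    proof -
      from that obtain y where "v = preadjoint T y" "c = real_part (blinfun_apply u y)"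
        unfolding G_def by blast
      with GI[of "r *\<^sub>R y"] show ?thesis
        by (simp add: preadjoint_scaleR blinfun.scaleR_right real_part_scaleR)
    qed
    show "0 \<le> 1 * norm (- v) + c" if vc: "(v, c) \<in> G" for v c
    proof -
      from vc obtain y where "v = preadjoint T y" "c = real_part (blinfun_apply u y)"
        unfolding G_def by blast
      with le[of y] real_part_le[of "blinfun_apply u y"] show ?thesis
        by simp
    qed
  qed
  then obtain \<psi> where \<psi>: "linear \<psi>" "\<And>f. \<psi> f \<le> 1 * norm f" "\<And>v c. (v, c) \<in> G \<Longrightarrow> \<psi> v \<le> c"
    by blast
  define \<Psi> where "\<Psi> = scalar_ext dual_scale \<psi>"
  have "\<Psi> \<in> functionals_on dual_scale UNIV" "norm (\<Psi> f) \<le> 1 * norm f" for f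
    unfolding \<Psi>_def using \<psi>(1,2) by (rule D.scalar_ext_in_functionals_on)+
  moreover have "\<Psi> (preadjoint T y) = blinfun_apply u y" for y
  \<comment> \<open>Multiples of \<open>preadjoint T y\<close> are again in the range, so the graph
    inequality at \<open>sY c y\<close> covers every \<open>c\<close>.\<close>
  proof (rule scalar_eqI)
    fix c
    have "real_part (c * \<Psi> (preadjoint T y)) = \<psi> (preadjoint T (sY c y))"
      unfolding \<Psi>_def preadjoint_scale[OF T]
      by (metis D.scalar_ext_scale[OF \<psi>(1)] D.real_part_scalar_ext[OF \<psi>(1)])
    also have "\<dots> \<le> real_part (blinfun_apply u (sY c y))"
      using GI by (rule \<psi>(3))
    also have "blinfun_apply u (sY c y) = c * blinfun_apply u y"
      using u by (simp add: dual_def)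
    finally show "real_part (c * \<Psi> (preadjoint T y)) \<le> real_part (c * blinfun_apply u y)" .
  qed
  ultimately show ?thesis by auto
qed

section \<open>Comparison of the norm and weak-star closures\<close>

lemma weak_star_closure_ball_image:
  fixes sX :: "'k::real_or_complex \<Rightarrow> 'x::banach \<Rightarrow> 'x" and sY :: "'k \<Rightarrow> 'y::banach \<Rightarrow> 'y"
  assumes sX: "banach_over sX" and sY: "banach_over sY"
    and gro: "grothendieck_property sX"
    and wcg: "weakly_compactly_generated dual_scale (dual sY)"
    and T: "T \<in> operators_to_dual sX sY" and u: "u \<in> dual sY"
    and uT: "u \<in> weak_star_topology sY closure_of (blinfun_apply T ` cball 0 1)"
  shows "u \<in> closure (blinfun_apply T ` cball 0 1)"
proof (rule ccontr)
  assume "\<not> ?thesis"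
  then obtain \<phi> M where \<phi>: "linear \<phi>" "0 < M" "\<And>f. \<phi> f \<le> M * norm f"
      "\<And>x. \<phi> (blinfun_apply T x) \<le> norm x" "1 < \<phi> u"
    using separation_from_ball_image by blast
  interpret DX: banach_over "dual_scale :: 'k \<Rightarrow> ('x \<Rightarrow>\<^sub>L 'k) \<Rightarrow> _"
    by (rule banach_over_dual_scale)
  interpret DY: banach_over "dual_scale :: 'k \<Rightarrow> ('y \<Rightarrow>\<^sub>L 'k) \<Rightarrow> _"
    by (rule banach_over_dual_scale)
  have T_scale: "blinfun_apply T (sX c x) = dual_scale c (blinfun_apply T x)" for c x
    using T by (simp add: operators_to_dual_def)
  define \<Phi> where "\<Phi> = scalar_ext dual_scale \<phi>"
  have \<Phi>: "\<Phi> \<in> functionals_on dual_scale UNIV" "norm (\<Phi> f) \<le> M * norm f" for f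
    unfolding \<Phi>_def using \<phi>(1,3) by (rule DY.scalar_ext_in_functionals_on)+
  have lin: "linear \<Phi>"
    using \<Phi>(1) by (rule DY.linear_functional)
  have \<Phi>T: "norm (\<Phi> (blinfun_apply T x)) \<le> norm x" for x
    unfolding \<Phi>_def
  proof (rule DY.norm_scalar_ext_le[OF \<phi>(1)])
    show "\<phi> (dual_scale c (blinfun_apply T x)) \<le> norm x" if "norm c = 1" for c
      using \<phi>(4)[of "sX c x"] that by (simp add: T_scale banach_over.norm_scale[OF sX])
  qed
  \<comment> \<open>The adjoint of \<open>T\<close> applied to \<open>\<Phi>\<close>, as a bounded
    map on \<open>'x\<close>.\<close>
  define g where "g = Blinfun (\<lambda>x. \<Phi> (blinfun_apply T x))"
  have "bounded_linear (\<lambda>x. \<Phi> (blinfun_apply T x))"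
    using \<Phi>T by (intro bounded_linear_intro[of _ 1])
      (auto simp: blinfun.bilinear_simps linear_add[OF lin] linear_scale[OF lin])
  then have g: "blinfun_apply g x = \<Phi> (blinfun_apply T x)" for x
    unfolding g_def by (rule bounded_linear_Blinfun_apply[THEN fun_cong])
  have g_dual: "g \<in> dual sX"
    using functionals_onD(2)[OF \<Phi>(1)] by (simp add: dual_def g T_scale)
  have g_norm: "norm g \<le> 1"
    using \<Phi>T by (intro norm_blinfun_bound) (auto simp: g)
  obtain y where y: "\<And>f. f \<in> dual sY \<Longrightarrow> (\<lambda>n. blinfun_apply f (y n)) \<longlonglongrightarrow> \<Phi> f"
    using goldstine_sequence[OF sY wcg \<Phi> \<phi>(2)] by blast
  \<comment> \<open>The Grothendieck property speaks of null sequences, so the limit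
    \<open>g\<close> is subtracted.\<close>
  define h where "h n = preadjoint T (y n) - g" for n
  have h_dual: "range h \<subseteq> dual sX"
    unfolding h_def using dual_diff[OF preadjoint_in_dual[OF T] g_dual] by blast
  have "limitin (weak_star_topology sX) h 0 sequentially"
    unfolding weak_star_topology_def
  proof (subst limitin_sigma_topology[OF _ h_dual dual_0], blast, rule ballI)
    fix \<xi> :: "('x \<Rightarrow>\<^sub>L 'k) \<Rightarrow> 'k" assume "\<xi> \<in> {\<lambda>f. blinfun_apply f x | x. True}"
    then obtain x where \<xi>: "\<xi> = (\<lambda>f. blinfun_apply f x)" by blast
    have "blinfun_apply T x \<in> dual sY"
      using T by (simp add: operators_to_dual_def)
    from tendsto_diff[OF y[OF this] tendsto_const[of "\<Phi> (blinfun_apply T x)"]]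
    show "(\<lambda>n. \<xi> (h n)) \<longlonglongrightarrow> \<xi> 0"
      by (simp add: \<xi> h_def blinfun.diff_left preadjoint.rep_eq g blinfun.zero_left)
  qed
  with gro h_dual have weak: "limitin (weak_topology dual_scale (dual sX)) h 0 sequentially"
    unfolding grothendieck_property_def by blast
  obtain \<Psi> where \<Psi>: "\<Psi> \<in> functionals_on dual_scale UNIV" "\<And>f. norm (\<Psi> f) \<le> norm f"
      "\<And>y. \<Psi> (preadjoint T y) = blinfun_apply u y"
    using factor_through_preadjoint[OF T u weak_star_closure_image_le[OF uT]] by blast
  have lin\<Psi>: "linear \<Psi>"
    using \<Psi>(1) by (rule DX.linear_functional)
  have \<Psi>': "\<Psi> \<in> functionals_on dual_scale (dual sX)"
    using functionals_on_subset[of "dual sX" UNIV] \<Psi>(1) by blast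
  then have "(\<lambda>n. \<Psi> (h n)) \<longlonglongrightarrow> \<Psi> 0"
    using weak limitin_sigma_topology[OF _ h_dual dual_0, of "functionals_on dual_scale (dual sX)"]
    unfolding weak_topology_def by blast
  then have "(\<lambda>n. blinfun_apply u (y n) - \<Psi> g) \<longlonglongrightarrow> 0"
    by (simp add: h_def linear_diff[OF lin\<Psi>] linear_0[OF lin\<Psi>] \<Psi>(3))
  then have "(\<lambda>n. blinfun_apply u (y n)) \<longlonglongrightarrow> \<Psi> g"
    by (rule LIM_zero_cancel)
  \<comment> \<open>The values of \<open>u\<close> along \<open>y\<close> tend to
    \<open>\<Phi> u\<close> by the choice of \<open>y\<close>, and to \<open>\<Psi> g\<close> by
    weak convergence.\<close>
  with y[OF u] have "\<Phi> u = \<Psi> g"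
    by (rule LIMSEQ_unique)
  moreover have "norm (\<Psi> g) \<le> 1"
    using \<Psi>(2)[of g] g_norm by simp
  moreover have "\<phi> u \<le> norm (\<Phi> u)"
    using real_part_le[of "\<Phi> u"] by (simp add: \<Phi>_def DY.real_part_scalar_ext[OF \<phi>(1)])
  ultimately show False
    using \<phi>(5) by simp
qed

text \<open>A norm-convergent sequence in \<open>S\<close> converges weak-star because evaluations
  are norm continuous, and the weak-star closure is closed under such limits.\<close>

lemma closure_subset_weak_star_closure:
  fixes s :: "'k::real_or_complex \<Rightarrow> 'y::banach \<Rightarrow> 'y"
  assumes S: "S \<subseteq> dual s" and u: "u \<in> closure S" "u \<in> dual s"
  shows "u \<in> weak_star_topology s closure_of S"
proof -
  obtain f where f: "\<And>n. f n \<in> S" "f \<longlonglongrightarrow> u"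
    using u(1) unfolding closure_sequential by blast
  have fd: "range f \<subseteq> dual s" using f(1) S by blast
  have "limitin (weak_star_topology s) f u sequentially"
    unfolding weak_star_topology_def
  proof (subst limitin_sigma_topology[OF _ fd u(2)], blast, rule ballI)
    fix \<xi> :: "('y \<Rightarrow>\<^sub>L 'k) \<Rightarrow> 'k" assume "\<xi> \<in> {\<lambda>f. blinfun_apply f x | x. True}"
    then obtain x where "\<xi> = (\<lambda>f. blinfun_apply f x)" by blast
    then show "(\<lambda>n. \<xi> (f n)) \<longlonglongrightarrow> \<xi> u"
      using f(2) by (auto intro: blinfun.tendsto)
  qed
  moreover have "f n \<in> weak_star_topology s closure_of S" for n
  proof -
    have "S \<subseteq> topspace (weak_star_topology s)"
      unfolding weak_star_topology_def by (subst topspace_sigma_topology) (use S in auto)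
    then show ?thesis
      using f(1) closure_of_subset by blast
  qed
  ultimately show ?thesis
    by (intro limitin_closedin[OF _ closedin_closure_of]) auto
qed

theorem proposition4p6:
  fixes sX :: "'k::real_or_complex \<Rightarrow> 'x::banach \<Rightarrow> 'x"
    and sY :: "'k \<Rightarrow> 'y::banach \<Rightarrow> 'y"
  assumes "banach_over sX"
    and "banach_over sY"
    and "grothendieck_property sX"
    and "weakly_compactly_generated dual_scale (dual sY)"
  shows "QNA sX sY = weak_star_QNA sX sY"
proof -
  \<comment> \<open>Both classes test their closure only on a sphere inside \<open>dual sY\<close>,
    so equality of the closures there suffices.\<close>
  have "u \<in> closure (blinfun_apply T ` cball 0 1) \<longleftrightarrow>
      u \<in> weak_star_topology sY closure_of (blinfun_apply T ` cball 0 1)"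
    if T: "T \<in> operators_to_dual sX sY" and u: "u \<in> dual sY" for T u
  proof
    have "blinfun_apply T ` cball 0 1 \<subseteq> dual sY"
      using T by (auto simp: operators_to_dual_def)
    then show "u \<in> weak_star_topology sY closure_of (blinfun_apply T ` cball 0 1)"
      if "u \<in> closure (blinfun_apply T ` cball 0 1)"
      using that u by (rule closure_subset_weak_star_closure)
  qed (rule weak_star_closure_ball_image[OF assms T u])
  then show ?thesis
    unfolding QNA_def weak_star_QNA_def by blast
qed

end
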